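(* Let $R$ be a commutative $\mathbb{Q}$-algebra. Then the formal groups $\mathbb{G}_a^{\mathbb{N}}(R)$ and $(\mathfrak{G}^1_+(R),\boxtimes)$ are isomorphic.
   Context: $\mathfrak{G}^1_+(R)$ is the set of formal power series $f=z+\sum_{n\ge2}r_nz^n$ with $r_n\in R$; write $X_n(f)$ for the coefficient of $z^n$. The boxed convolution is $X_n(f\boxtimes g)=\sum_{\pi\in \operatorname{NC}(n)}X_{\pi}(f)\cdot X_{K(\pi)}(g)$, where $\operatorname{NC}(n)$ is the set of non-crossing partitions of $\{1,\dots,n\}$, $X_\pi(f)=\prod_{V\in\pi}X_{|V|}(f)$, and $K(\pi)$ is the Kreweras complement, i.e. the largest partition of $\{\bar1,\dots,\bar n\}\cong\{1,\dots,n\}$ such that $\pi\cup K(\pi)$ is non-crossing on $1<\bar1<2<\bar2<\dots<n<\bar n$. In the coordinates $x_n=X_n$, $n\ge2$, this operation is given by polynomials $F_n(x,y)$ with integer coefficients involving only $x_m,y_m$ with $m\le n$, and $F=(F_n)_{n\ge2}$ is an infinite-dimensional commutative formal group law. $\mathbb{G}_a^{\mathbb{N}}$ is the additive group in countably many coordinates (formal group law $x_n+y_n$ in each coordinate). An isomorphism of these formal groups over $R$ is a family $\theta=(\theta_n)_{n\ge2}$ of formal power series over $R$ without constant term, each $\theta_n$ in finitely many of the variables $x_2,x_3,\dots$, which is invertible under composition by a family of the same kind and satisfies $\theta_n(F(x,y))=\theta_n(x)+\theta_n(y)$ for all $n$. *)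

theory Defs
  imports
    "HOL-Library.Poly_Mapping"
    "HOL-Library.Disjoint_Sets"
    "HOL-Computational_Algebra.Formal_Power_Series"
begin

section \<open>Formal power series in a set of variables\<close>

text \<open>
  A monomial in variables of type \<open>'v\<close> is a finitely supported exponent function; an arbitrary
  family of coefficients indexed by monomials is a formal power series.
  Coefficients range over commutative unital rings. These are described by the sort
  \<open>{comm_ring, comm_monoid_mult}\<close> rather than by \<open>comm_ring_1\<close>, because the latter excludes the
  zero ring.
\<close>

typedef ('v, 'a) mfps = "UNIV :: (('v \<Rightarrow>\<^sub>0 nat) \<Rightarrow> 'a) set"
  morphisms mcoeff Abs_mfps by simp

lemma mcoeff_Abs [simp]: "mcoeff (Abs_mfps c) m = c m"
  by (simp add: Abs_mfps_inverse)

lemma mfps_eqI: "(\<And>m. mcoeff f m = mcoeff g m) \<Longrightarrow> f = g"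
  by (metis ext mcoeff_inject)

instantiation mfps :: (type, zero) zero
begin
definition "0 = Abs_mfps (\<lambda>m. 0)"
instance ..
end

instantiation mfps :: (type, "{zero, one}") one
begin
definition "1 = Abs_mfps (\<lambda>m. if m = 0 then 1 else 0)"
instance ..
end

instantiation mfps :: (type, plus) plus
begin
definition "f + g = Abs_mfps (\<lambda>m. mcoeff f m + mcoeff g m)"
instance ..
end

instantiation mfps :: (type, uminus) uminus
begin
definition "- f = Abs_mfps (\<lambda>m. - mcoeff f m)"
instance ..
end

instantiation mfps :: (type, minus) minus
begin
definition "f - g = Abs_mfps (\<lambda>m. mcoeff f m - mcoeff g m)"
instance ..
end

instantiation mfps :: (type, comm_ring) times
begin
definition "f * g = Abs_mfps (\<lambda>m. \<Sum>(a, b) | a + b = m. mcoeff f a * mcoeff g b)"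
instance ..
end

lemma mcoeff_zero [simp]: "mcoeff 0 m = 0"
  and mcoeff_one: "mcoeff 1 m = (if m = 0 then 1 else 0)"
  and mcoeff_add [simp]: "mcoeff (f + g) m = mcoeff f m + mcoeff g m"
  and mcoeff_uminus [simp]: "mcoeff (- f') m = - mcoeff f' m"
  and mcoeff_minus [simp]: "mcoeff (f'' - g'') m = mcoeff f'' m - mcoeff g'' m"
  by (simp_all add: zero_mfps_def one_mfps_def plus_mfps_def uminus_mfps_def minus_mfps_def)

lemma mcoeff_mult: "mcoeff (f * g) m = (\<Sum>(a, b) | a + b = m. mcoeff f a * mcoeff g b)"
  by (simp add: times_mfps_def)

lemma finite_monomial_splits: "finite {(a, b). a + b = (m :: 'v \<Rightarrow>\<^sub>0 nat)}"
proof -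
  let ?K = "Poly_Mapping.keys m" and ?l = "Poly_Mapping.lookup m"
  let ?F = "{h. \<forall>i. (i \<in> ?K \<longrightarrow> h i \<in> {..Max (?l ` ?K)}) \<and> (i \<notin> ?K \<longrightarrow> h i = (0::nat))}"
  have "finite ?F"
    by (rule finite_set_of_finite_funs) auto
  moreover have "(Poly_Mapping.lookup \<circ> fst) ` {(a, b). a + b = m} \<subseteq> ?F"
  proof (intro subsetI, clarify, intro conjI impI)
    fix a b :: "'v \<Rightarrow>\<^sub>0 nat" and i
    assume "i \<in> Poly_Mapping.keys (a + b)"
    then have "Poly_Mapping.lookup (a + b) i \<in> Poly_Mapping.lookup (a + b) ` Poly_Mapping.keys (a + b)"
      by (rule imageI)
    then have "Poly_Mapping.lookup (a + b) i \<le> Max \<dots>"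
      by (intro Max_ge finite_imageI finite_keys)
    then show "(Poly_Mapping.lookup \<circ> fst) (a, b) i
        \<in> {..Max (Poly_Mapping.lookup (a + b) ` Poly_Mapping.keys (a + b))}"
      by (simp add: lookup_add)
  qed (simp add: in_keys_iff lookup_add)
  moreover have "inj_on (Poly_Mapping.lookup \<circ> fst) {(a, b). a + b = m}"
    by (auto simp: inj_on_def lookup_inject)
  ultimately show ?thesis
    by (rule finite_imageD[OF finite_subset[rotated]])
qed

instance mfps :: (type, comm_ring) comm_ring
proof
  fix f g h :: "('a, 'b) mfps"
  show "f + g + h = f + (g + h)" "f + g = g + f" "0 + f = f" "- f + f = 0" "f - g = f + - g"
    by (rule mfps_eqI, simp add: add.assoc add.commute)+
  show "f * g = g * f"
  proof (rule mfps_eqI)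
    fix m
    show "mcoeff (f * g) m = mcoeff (g * f) m"
      unfolding mcoeff_mult
      by (rule sum.reindex_bij_witness[of _ prod.swap prod.swap])
         (auto simp: add.commute mult.commute)
  qed
  show "(f + g) * h = f * h + g * h"
    by (rule mfps_eqI) (simp add: mcoeff_mult distrib_right case_prod_unfold sum.distrib)
  show "f * g * h = f * (g * h)"
  proof (rule mfps_eqI)
    fix m
    let ?S = "\<lambda>m :: 'a \<Rightarrow>\<^sub>0 nat. {(a, b). a + b = m}"
    let ?c = "mcoeff f" and ?d = "mcoeff g" and ?e = "mcoeff h"
    have "mcoeff (f * g * h) m = (\<Sum>p\<in>?S m. \<Sum>q\<in>?S (fst p). ?c (fst q) * ?d (snd q) * ?e (snd p))"
      by (simp add: mcoeff_mult case_prod_unfold sum_distrib_right)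
    also have "\<dots> = (\<Sum>(p, q)\<in>Sigma (?S m) (\<lambda>p. ?S (fst p)). ?c (fst q) * ?d (snd q) * ?e (snd p))"
      by (rule sum.Sigma) (auto intro: finite_monomial_splits)
    also have "\<dots> = (\<Sum>(p, q)\<in>Sigma (?S m) (\<lambda>p. ?S (snd p)). ?c (fst p) * (?d (fst q) * ?e (snd q)))"
      by (rule sum.reindex_bij_witness[of _
            "\<lambda>(p, q). ((fst p + fst q, snd q), (fst p, fst q))"
            "\<lambda>(p, q). ((fst q, snd q + snd p), (snd q, snd p))"])
         (auto simp: add.assoc mult.assoc)
    also have "\<dots> = (\<Sum>p\<in>?S m. \<Sum>q\<in>?S (snd p). ?c (fst p) * (?d (fst q) * ?e (snd q)))"
      by (rule sum.Sigma[symmetric]) (auto intro: finite_monomial_splits)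
    also have "\<dots> = mcoeff (f * (g * h)) m"
      by (simp add: mcoeff_mult case_prod_unfold sum_distrib_left)
    finally show "mcoeff (f * g * h) m = mcoeff (f * (g * h)) m" .
  qed
qed

instance mfps :: (type, "{comm_ring, comm_monoid_mult}") comm_monoid_mult
proof
  fix f :: "('a, 'b) mfps"
  show "1 * f = f"
  proof (rule mfps_eqI)
    fix m
    have "mcoeff (1 * f) m = (\<Sum>(a, b)\<in>{(0, m)}. mcoeff (1 :: ('a, 'b) mfps) a * mcoeff f b)"
      unfolding mcoeff_mult
      by (rule sum.mono_neutral_right) (auto simp: mcoeff_one finite_monomial_splits split: if_splits)
    then show "mcoeff (1 * f) m = mcoeff f m" by (simp add: mcoeff_one)
  qed
qed

instance mfps :: (type, comm_ring_1) comm_ring_1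
proof
  show "(0 :: ('a, 'b) mfps) \<noteq> 1"
  proof
    assume *: "(0 :: ('a, 'b) mfps) = 1"
    have "mcoeff (0 :: ('a, 'b) mfps) 0 = mcoeff (1 :: ('a, 'b) mfps) 0"
      by (simp only: *)
    then show False
      by (simp add: mcoeff_one)
  qed
qed

definition mvar :: "'v \<Rightarrow> ('v, 'a::{zero, one}) mfps" where
  "mvar v = Abs_mfps (\<lambda>m. if m = Poly_Mapping.single v 1 then 1 else 0)"

definition mvars :: "('v, 'a::zero) mfps \<Rightarrow> 'v set" where
  "mvars f = {v. \<exists>m. mcoeff f m \<noteq> 0 \<and> v \<in> Poly_Mapping.keys m}"

text \<open>
  Substitution of a family \<open>g\<close> for the variables of \<open>f\<close>. For every monomial \<open>m\<close> only finitely many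
  summands are nonzero as soon as \<open>f\<close> involves finitely many variables and the \<open>g v\<close> have no
  constant term; \<open>Sum_any\<close> sums over the nonzero summands.
\<close>

definition msubst ::
  "('v, 'a::{comm_ring, comm_monoid_mult}) mfps \<Rightarrow> ('v \<Rightarrow> ('w, 'a) mfps) \<Rightarrow> ('w, 'a) mfps" where
  "msubst f g =
     Abs_mfps (\<lambda>m. Sum_any (\<lambda>k. mcoeff f k *
       mcoeff (\<Prod>v\<in>Poly_Mapping.keys k. g v ^ Poly_Mapping.lookup k v) m))"



section \<open>Isomorphisms of formal group laws\<close>

text \<open>
  The coordinates are indexed by a set \<open>I\<close>, and entries of a family outside \<open>I\<close> are irrelevant.
  A formal group law is a family of series in two sets of variables, \<open>x\<^sub>i\<close> being \<open>mvar (Inl i)\<close> and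
  \<open>y\<^sub>i\<close> being \<open>mvar (Inr i)\<close>.
\<close>

definition admissible :: "'i set \<Rightarrow> ('i \<Rightarrow> ('i, 'a::zero) mfps) \<Rightarrow> bool" where
  "admissible I \<theta> \<longleftrightarrow>
     (\<forall>i\<in>I. mcoeff (\<theta> i) 0 = 0 \<and> finite (mvars (\<theta> i)) \<and> mvars (\<theta> i) \<subseteq> I)"

definition inverse_families ::
  "'i set \<Rightarrow> ('i \<Rightarrow> ('i, 'a::{comm_ring, comm_monoid_mult}) mfps) \<Rightarrow> ('i \<Rightarrow> ('i, 'a) mfps) \<Rightarrow> bool" where
  "inverse_families I \<theta> \<eta> \<longleftrightarrow>
     (\<forall>i\<in>I. msubst (\<theta> i) \<eta> = mvar i \<and> msubst (\<eta> i) \<theta> = mvar i)"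

definition in_x :: "('i, 'a::{comm_ring, comm_monoid_mult}) mfps \<Rightarrow> ('i + 'i, 'a) mfps" where
  "in_x f = msubst f (\<lambda>i. mvar (Inl i))"

definition in_y :: "('i, 'a::{comm_ring, comm_monoid_mult}) mfps \<Rightarrow> ('i + 'i, 'a) mfps" where
  "in_y f = msubst f (\<lambda>i. mvar (Inr i))"

text \<open>\<open>\<theta>(F(x, y)) = G(\<theta>(x), \<theta>(y))\<close>\<close>

definition intertwines ::
  "'i set \<Rightarrow> ('i \<Rightarrow> ('i + 'i, 'a::{comm_ring, comm_monoid_mult}) mfps)
     \<Rightarrow> ('i \<Rightarrow> ('i + 'i, 'a) mfps) \<Rightarrow> ('i \<Rightarrow> ('i, 'a) mfps) \<Rightarrow> bool" where
  "intertwines I F G \<theta> \<longleftrightarrow>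
     (\<forall>i\<in>I. msubst (\<theta> i) F =
        msubst (G i) (case_sum (\<lambda>j. in_x (\<theta> j)) (\<lambda>j. in_y (\<theta> j))))"

definition formal_groups_isomorphic ::
  "'i set \<Rightarrow> ('i \<Rightarrow> ('i + 'i, 'a::{comm_ring, comm_monoid_mult}) mfps)
     \<Rightarrow> ('i \<Rightarrow> ('i + 'i, 'a) mfps) \<Rightarrow> bool" where
  "formal_groups_isomorphic I F G \<longleftrightarrow>
     (\<exists>\<theta>. admissible I \<theta> \<and> (\<exists>\<eta>. admissible I \<eta> \<and> inverse_families I \<theta> \<eta>)
        \<and> intertwines I F G \<theta>)"

definition additive_law :: "'i \<Rightarrow> ('i + 'i, 'a::{comm_ring, comm_monoid_mult}) mfps" where
  "additive_law i = mvar (Inl i) + mvar (Inr i)"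


section \<open>Boxed convolution\<close>

definition noncrossing :: "nat set set \<Rightarrow> bool" where
  "noncrossing P \<longleftrightarrow>
     \<not> (\<exists>A\<in>P. \<exists>B\<in>P. A \<noteq> B \<and> (\<exists>a\<in>A. \<exists>b\<in>B. \<exists>c\<in>A. \<exists>d\<in>B. a < b \<and> b < c \<and> c < d))"

definition NC :: "nat \<Rightarrow> nat set set set" where
  "NC n = {\<pi>. partition_on {1..n} \<pi> \<and> noncrossing \<pi>}"

text \<open>
  \<open>\<pi> \<union> \<sigma>\<close> as a partition of \<open>1 < \<bar>1 < 2 < \<bar>2 < \<dots> < n < \<bar>n\<close>, where \<open>i\<close> is represented by \<open>2 * i\<close>
  and \<open>\<bar>i\<close> by \<open>2 * i + 1\<close>.
\<close>

definition interleave :: "nat set set \<Rightarrow> nat set set \<Rightarrow> nat set set" where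
  "interleave \<pi> \<sigma> = (\<lambda>V. (\<lambda>i. 2 * i) ` V) ` \<pi> \<union> (\<lambda>V. (\<lambda>i. 2 * i + 1) ` V) ` \<sigma>"

definition kreweras :: "nat \<Rightarrow> nat set set \<Rightarrow> nat set set" where
  "kreweras n \<pi> =
     (THE \<sigma>. partition_on {1..n} \<sigma> \<and> noncrossing (interleave \<pi> \<sigma>) \<and>
        (\<forall>\<tau>. partition_on {1..n} \<tau> \<and> noncrossing (interleave \<pi> \<tau>) \<longrightarrow> refines {1..n} \<tau> \<sigma>))"

definition X_part :: "'a::comm_monoid_mult fps \<Rightarrow> nat set set \<Rightarrow> 'a" where
  "X_part f \<pi> = (\<Prod>V\<in>\<pi>. fps_nth f (card V))"

definition boxed_conv ::
  "'a::{comm_ring, comm_monoid_mult} fps \<Rightarrow> 'a fps \<Rightarrow> 'a fps" (infixl \<open>\<boxtimes>\<close> 70) where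
  "f \<boxtimes> g =
     Abs_fps (\<lambda>n. if n = 0 then 0 else \<Sum>\<pi>\<in>NC n. X_part f \<pi> * X_part g (kreweras n \<pi>))"

definition G1 :: "'a::{zero, one} fps set" where
  "G1 = {f. fps_nth f 0 = 0 \<and> fps_nth f 1 = 1}"

text \<open>The element \<open>z + (\<Sum>n\<ge>2. c n * z^n)\<close> of \<open>G1\<close> with coordinates \<open>c\<close>\<close>

definition G1_elem :: "(nat \<Rightarrow> 'a) \<Rightarrow> 'a::{zero, one} fps" where
  "G1_elem c = Abs_fps (\<lambda>n. if n = 0 then 0 else if n = 1 then 1 else c n)"

lemma G1_eq_range: "G1 = range G1_elem"
proof (intro equalityI subsetI)
  fix f :: "'a fps"
  assume "f \<in> G1"
  then have "f = G1_elem (fps_nth f)"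
    by (intro fps_ext) (auto simp: G1_def G1_elem_def)
  then show "f \<in> range G1_elem"
    by (rule range_eqI[of f G1_elem "fps_nth f"])
qed (auto simp: G1_def G1_elem_def)

text \<open>
  The polynomials \<open>F\<^sub>n(x, y)\<close> giving \<open>\<boxtimes>\<close> in the coordinates \<open>X\<^sub>n\<close>: the coordinates of the product
  of the two generic elements \<open>z + (\<Sum>n\<ge>2. x\<^sub>n z^n)\<close> and \<open>z + (\<Sum>n\<ge>2. y\<^sub>n z^n)\<close>. These form the formal
  group law on the coordinates \<open>n \<ge> 2\<close>.
\<close>

definition boxed_law :: "nat \<Rightarrow> (nat + nat, 'a::{comm_ring, comm_monoid_mult}) mfps" where
  "boxed_law n =
     fps_nth (G1_elem (\<lambda>i. mvar (Inl i)) \<boxtimes> G1_elem (\<lambda>i. mvar (Inr i))) n"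


section \<open>Commutative algebras over the rationals\<close>

locale comm_rat_algebra = vector_space scale
  for scale :: "rat \<Rightarrow> 'a \<Rightarrow> 'a::{comm_ring, comm_monoid_mult}" +
  assumes scale_mult_left: "scale q (x * y) = scale q x * y"

end

theory Submission
  imports Defs
begin

text \<open>
  The isomorphism is the logarithm of the S-transform. For \<open>f\<close> in \<open>G1\<close> with compositional inverse \<open>h\<close>
  put \<open>S\<^sub>f = h/z\<close>. The S-transform turns boxed convolution into multiplication, so the
  coefficients of its logarithmic derivative \<open>z S\<^sub>f'/S\<^sub>f\<close> are additive. The shifted series
  \<open>T\<^sub>f = 1 + z S\<^sub>f'/S\<^sub>f = z h'/h\<close> can be reached without inverting anything: substituting \<open>f\<close> for
  the variable shows that \<open>T\<^sub>f\<close> is the only series with \<open>f = z f' (T\<^sub>f \<circ> f)\<close>. Comparing coefficients in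
  this equation yields a recursion for the coefficients of \<open>T\<^sub>f\<close> (\<open>log_coord\<close>), from which it is visible
  that the \<open>n\<close>-th one equals \<open>- n f\<^sub>n\<^sub>+\<^sub>1\<close> plus a polynomial in \<open>f\<^sub>2, \<dots>, f\<^sub>n\<close> with integer coefficients.
  Where all positive integers are invertible, such a triangular change of coordinates has a polynomial
  inverse.

  Additivity (\<open>log_coord_boxed_conv\<close>) follows, by differentiating, from series \<open>A\<close>, \<open>B\<close> without
  constant term such that

    \<open>f \<boxtimes> g = f \<circ> A = g \<circ> B\<close>  and  \<open>A B = z (f \<boxtimes> g)\<close>

  (\<open>boxed_conv_functional_equations\<close>); these equations say that \<open>S\<close> is multiplicative. They come from
  a decomposition of noncrossing partitions. If the block of the first point has a next element, then
  the points strictly between these two elements carry an arbitrary noncrossing partition, the points from the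
  next element on carry another one, and the Kreweras complement splits accordingly; if
  the first point is isolated, it is simply removed. The resulting recursion (\<open>NC_sum_rec\<close>) is closed
  for sums over noncrossing partitions in which the block of the first point and the complementary block
  of the last point are weighted by functions of their own, and solving it gives the two compositions.

  The isomorphism is constructed over the rationals and transported along \<open>\<rat> \<rightarrow> R\<close>, which is possible
  because both formal group laws have integer coefficients. All series involved in it are polynomials,
  so substitution into them is evaluation, a ring homomorphism.
\<close>

unbundle fps_syntax

section \<open>Blocks of a partition\<close>

text \<open>
  The block is a union over all members containing \<open>x\<close>, so that it is empty for points outside the
  partitioned set. Weights of an empty interval rely on this default.
\<close>

definition block :: "'i set set \<Rightarrow> 'i \<Rightarrow> 'i set" where
  "block \<pi> x = {y. \<exists>A\<in>\<pi>. x \<in> A \<and> y \<in> A}"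

text \<open>
  The point \<open>x\<close> joins the block of \<open>y\<close>; if \<open>y\<close> lies outside the partitioned set, then \<open>x\<close> becomes a
  singleton block. The second case is what makes the formulas below uniform when a gap is empty.
\<close>

definition adjoin :: "'i \<Rightarrow> 'i \<Rightarrow> 'i set set \<Rightarrow> 'i set set" where
  "adjoin x y \<pi> = insert (insert x (block \<pi> y)) (\<pi> - {block \<pi> y})"

lemma block_eq:
  assumes P: "partition_on S P" and A: "A \<in> P" "x \<in> A"
  shows "block P x = A"
proof -
  have "B = A" if "B \<in> P" "x \<in> B" for B
    using that A pairwiseD[OF partition_onD2[OF P], of A B] by (auto simp: disjnt_iff)
  with A show ?thesis unfolding block_def by blast
qed

lemma block_in:
  assumes P: "partition_on S P" and "x \<in> S"
  shows "block P x \<in> P"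
proof -
  obtain A where A: "A \<in> P" "x \<in> A"
    using \<open>x \<in> S\<close> unfolding partition_onD1[OF P] by blast
  with block_eq[OF P A] show ?thesis by (simp only:)
qed

lemma block_self: "partition_on S P \<Longrightarrow> x \<in> S \<Longrightarrow> x \<in> block P x"
  by (auto simp: block_def partition_on_def)

lemma block_outside: "partition_on S P \<Longrightarrow> x \<notin> S \<Longrightarrow> block P x = {}"
  by (auto simp: block_def partition_on_def)

lemma block_subset: "partition_on S P \<Longrightarrow> block P x \<subseteq> S"
  by (auto simp: block_def partition_on_def)

lemma partition_eq_blocks: "partition_on S P \<Longrightarrow> P = block P ` S"
proof (intro equalityI subsetI)
  fix A assume P: "partition_on S P" and A: "A \<in> P"
  then obtain x where x: "x \<in> A" using partition_onD3[OF P] by (cases "A = {}") auto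
  then have "A = block P x" using block_eq[OF P A] by simp
  moreover have "x \<in> S" using x A partition_onD1[OF P] by auto
  ultimately show "A \<in> block P ` S" by (rule image_eqI)
qed (auto intro: block_in)

lemma partition_eqI:
  assumes "partition_on S P" "partition_on S Q" "\<And>x. x \<in> S \<Longrightarrow> block P x = block Q x"
  shows "P = Q"
proof -
  have "P = block P ` S" by (rule partition_eq_blocks[OF assms(1)])
  also have "\<dots> = block Q ` S" using assms(3) by (rule image_cong[OF refl])
  also have "\<dots> = Q" by (rule partition_eq_blocks[OF assms(2), symmetric])
  finally show ?thesis .
qed

lemma partition_on_adjoin:
  assumes P: "partition_on S P" and x: "x \<notin> S"
  shows "partition_on (insert x S) (adjoin x y P)"
proof (rule partition_onI)
  let ?U = "block P y"
  have "?U \<union> \<Union>(P - {?U}) = S"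
    using block_subset[OF P, of y] partition_onD1[OF P] by auto
  then show "\<Union>(adjoin x y P) = insert x S"
    by (simp add: adjoin_def)
  have new: "disjnt (insert x ?U) A" if "A \<in> P - {?U}" for A
  proof -
    have "z \<notin> A" if "z \<in> ?U" for z
    proof
      assume "z \<in> A"
      then have "block P z = A" using \<open>A \<in> P - {?U}\<close> by (intro block_eq[OF P]) auto
      moreover obtain B where "B \<in> P" "y \<in> B" "z \<in> B" using \<open>z \<in> ?U\<close> by (auto simp: block_def)
      then have "block P z = B" "?U = B" using block_eq[OF P \<open>B \<in> P\<close>] by simp_all
      ultimately show False using \<open>A \<in> P - {?U}\<close> by simp
    qed
    moreover have "x \<notin> A" using x that partition_onD1[OF P] by auto
    ultimately show ?thesis by (auto simp: disjnt_def)
  qed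
  have old: "disjnt A B" if "A \<in> P" "B \<in> P" "A \<noteq> B" for A B
    using that partition_onD2[OF P] by (auto simp: disjoint_def disjnt_def)
  show "disjnt A B" if AB: "A \<in> adjoin x y P" "B \<in> adjoin x y P" "A \<noteq> B" for A B
  proof -
    consider "A = insert x ?U" "B \<in> P - {?U}" | "B = insert x ?U" "A \<in> P - {?U}" | "A \<in> P" "B \<in> P"
      using AB unfolding adjoin_def by blast
    then show ?thesis
      by cases (use new[of B] new[of A, THEN disjnt_sym] old[OF _ _ \<open>A \<noteq> B\<close>] in simp_all)
  qed
qed (use partition_onD3[OF P] in \<open>auto simp: adjoin_def\<close>)

lemma block_adjoin:
  assumes P: "partition_on S P" and x: "x \<notin> S"
  shows "block (adjoin x y P) z =
    (if z = x \<or> z \<in> block P y then insert x (block P y) else block P z)"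
proof -
  note Q = partition_on_adjoin[OF P x, of y]
  show ?thesis
  proof (cases "z = x \<or> z \<in> block P y")
    case True
    then show ?thesis using block_eq[OF Q, of "insert x (block P y)" z]
      by (auto simp: adjoin_def)
  next
    case False
    show ?thesis
    proof (cases "z \<in> S")
      case True
      then have "block P z \<in> P" "z \<in> block P z" using P by (auto intro: block_in block_self)
      moreover from this False have "block P z \<noteq> block P y" by auto
      ultimately have "block P z \<in> adjoin x y P" "z \<in> block P z" by (auto simp: adjoin_def)
      with False show ?thesis using block_eq[OF Q] by auto
    next
      case z: False
      with False show ?thesis using P Q by (auto simp: block_outside)
    qed
  qed
qed

lemma partition_on_Un:
  assumes P: "partition_on S P" and Q: "partition_on T Q" and "S \<inter> T = {}"
  shows "partition_on (S \<union> T) (P \<union> Q)"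
proof (rule partition_onI)
  have *: "disjnt p q" if "p \<in> P" "q \<in> Q" for p q
    using that assms(3) partition_onD1[OF P] partition_onD1[OF Q] by (auto simp: disjnt_def)
  show "disjnt p q" if "p \<in> P \<union> Q" "q \<in> P \<union> Q" "p \<noteq> q" for p q
    using that *[of p q] *[of q p, THEN disjnt_sym] pairwiseD[OF partition_onD2[OF P], of p q]
      pairwiseD[OF partition_onD2[OF Q], of p q] by auto
qed (use P Q in \<open>auto simp: partition_on_def\<close>)

lemma block_Un:
  assumes P: "partition_on S P" and Q: "partition_on T Q" and "S \<inter> T = {}"
  shows "block (P \<union> Q) z = (if z \<in> S then block P z else block Q z)"
proof -
  have "block (P \<union> Q) z = block P z \<union> block Q z"
    by (auto simp: block_def)
  moreover have "z \<in> S \<Longrightarrow> block Q z = {}" "z \<notin> S \<Longrightarrow> block P z = {}"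
    using assms by (auto intro!: block_outside)
  ultimately show ?thesis by auto
qed

section \<open>An explicit Kreweras complement\<close>

text \<open>
  No block meets both the interval between \<open>i\<close> and \<open>j\<close> (its smaller end excluded, its larger end included) and
  the rest: for \<open>i \<le> j\<close> the formula says that \<open>{i<..j}\<close> is a union of blocks. Written with equivalences,
  the relation is symmetric and transitive on sight.
\<close>

definition unseparated :: "nat set set \<Rightarrow> nat \<Rightarrow> nat \<Rightarrow> bool" where
  "unseparated \<pi> i j \<longleftrightarrow> (\<forall>A\<in>\<pi>. \<forall>x\<in>A. \<forall>y\<in>A. (i < x \<longleftrightarrow> j < x) \<longleftrightarrow> (i < y \<longleftrightarrow> j < y))"

text \<open>
  The bars of \<open>i < j\<close> may be joined without crossing \<open>\<pi>\<close> exactly when no block of \<open>\<pi>\<close> leads from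
  \<open>{i<..j}\<close> to the outside. This formula for the Kreweras complement is usable on every interval
  \<open>{a<..b}\<close>, hence in inductions.
\<close>

definition complement :: "nat \<Rightarrow> nat \<Rightarrow> nat set set \<Rightarrow> nat set set" where
  "complement a b \<pi> = (\<lambda>i. {j \<in> {a<..b}. unseparated \<pi> i j}) ` {a<..b}"

lemma unseparated_refl [simp]: "unseparated \<pi> i i"
  by (simp add: unseparated_def)

lemma unseparatedD:
  "unseparated \<pi> i j \<Longrightarrow> A \<in> \<pi> \<Longrightarrow> x \<in> A \<Longrightarrow> y \<in> A \<Longrightarrow> (i < x \<longleftrightarrow> j < x) \<longleftrightarrow> (i < y \<longleftrightarrow> j < y)"
  unfolding unseparated_def by (elim ballE) (assumption | erule notE)+

lemma unseparated_sym:
  assumes "unseparated \<pi> i j"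
  shows "unseparated \<pi> j i"
  unfolding unseparated_def
proof (intro ballI)
  fix A x y assume "A \<in> \<pi>" "x \<in> A" "y \<in> A"
  from unseparatedD[OF assms this]
  show "(j < x \<longleftrightarrow> i < x) \<longleftrightarrow> (j < y \<longleftrightarrow> i < y)" by argo
qed

lemma unseparated_trans:
  assumes "unseparated \<pi> i j" "unseparated \<pi> j k"
  shows "unseparated \<pi> i k"
  unfolding unseparated_def
proof (intro ballI)
  fix A x y assume "A \<in> \<pi>" "x \<in> A" "y \<in> A"
  from unseparatedD[OF assms(1) this] unseparatedD[OF assms(2) this]
  show "(i < x \<longleftrightarrow> k < x) \<longleftrightarrow> (i < y \<longleftrightarrow> k < y)" by argo
qed

lemma partition_on_complement: "partition_on {a<..b} (complement a b \<pi>)"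
proof (rule partition_onI)
  fix p q assume "p \<in> complement a b \<pi>" "q \<in> complement a b \<pi>" "p \<noteq> q"
  then obtain i j where "p = {k \<in> {a<..b}. unseparated \<pi> i k}" "q = {k \<in> {a<..b}. unseparated \<pi> j k}"
    by (auto simp: complement_def)
  moreover have "p = q" if "k \<in> p" "k \<in> q" for k
  proof -
    have "unseparated \<pi> i k" "unseparated \<pi> j k" using that calculation by auto
    then have "unseparated \<pi> i l \<longleftrightarrow> unseparated \<pi> j l" for l
      by (metis unseparated_sym unseparated_trans)
    with calculation show ?thesis by simp
  qed
  ultimately show "disjnt p q"
    using \<open>p \<noteq> q\<close> by (auto simp: disjnt_def)
qed (auto simp: complement_def)

lemma block_complement:
  "i \<in> {a<..b} \<Longrightarrow> block (complement a b \<pi>) i = {j \<in> {a<..b}. unseparated \<pi> i j}"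
  by (rule block_eq[OF partition_on_complement]) (simp_all add: complement_def)

section \<open>Decomposition of noncrossing partitions at the first block\<close>

definition NCI :: "nat \<Rightarrow> nat \<Rightarrow> nat set set set" where
  "NCI a b = {\<pi>. partition_on {a<..b} \<pi> \<and> noncrossing \<pi>}"

lemma noncrossingD:
  assumes "noncrossing P" "A \<in> P" "B \<in> P" "x \<in> A" "y \<in> B" "z \<in> A" "w \<in> B" "x < y" "y < z" "z < w"
  shows "A = B"
proof (rule ccontr)
  assume "A \<noteq> B"
  with assms have "\<exists>A\<in>P. \<exists>B\<in>P. A \<noteq> B \<and> (\<exists>a\<in>A. \<exists>b\<in>B. \<exists>c\<in>A. \<exists>d\<in>B. a < b \<and> b < c \<and> c < d)"
    by (intro bexI[of _ A] bexI[of _ B] conjI bexI[of _ x] bexI[of _ y] bexI[of _ z] bexI[of _ w])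
  with \<open>noncrossing P\<close> show False unfolding noncrossing_def by (rule notE)
qed

lemma noncrossingI:
  assumes "\<And>A B x y z w. A \<in> P \<Longrightarrow> B \<in> P \<Longrightarrow> x \<in> A \<Longrightarrow> y \<in> B \<Longrightarrow> z \<in> A \<Longrightarrow> w \<in> B \<Longrightarrow>
    x < y \<Longrightarrow> y < z \<Longrightarrow> z < w \<Longrightarrow> A = B"
  shows "noncrossing P"
  unfolding noncrossing_def
proof (rule notI, elim bexE conjE)
  fix A B x y z w
  assume *: "A \<in> P" "B \<in> P" "x \<in> A" "y \<in> B" "z \<in> A" "w \<in> B" "x < y" "y < z" "z < w" and "A \<noteq> B"
  from assms[OF *] \<open>A \<noteq> B\<close> show False by simp
qed

text \<open>
  Shrinking and discarding blocks creates no crossing, provided that no block is split in two.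
\<close>

lemma noncrossing_embed:
  assumes "noncrossing \<pi>" "\<And>A. A \<in> \<tau> \<Longrightarrow> A \<subseteq> \<phi> A \<and> \<phi> A \<in> \<pi>" "inj_on \<phi> \<tau>"
  shows "noncrossing \<tau>"
proof (rule noncrossingI)
  fix A B x y z w
  assume A: "A \<in> \<tau>" "B \<in> \<tau>" "x \<in> A" "y \<in> B" "z \<in> A" "w \<in> B" and o: "x < y" "y < z" "z < w"
  then have "\<phi> A = \<phi> B"
    using assms(2)[OF A(1)] assms(2)[OF A(2)]
    by (intro noncrossingD[OF assms(1) _ _ _ _ _ _ o]) blast+
  with A assms(3) show "A = B" by (meson inj_onD)
qed

text \<open>
  Inserting an isolated point in front: the bars of the new point and of the last one enclose the
  whole old partition, so the new point joins the complementary block of the last point.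
\<close>

lemma adjoin_complement:
  assumes \<sigma>: "partition_on {Suc a<..b} \<sigma>" and "a < b"
  shows "complement a b \<sigma> = adjoin (Suc a) b (complement (Suc a) b \<sigma>)" (is "_ = adjoin _ _ ?K")
proof (rule partition_eqI[OF partition_on_complement])
  have eq: "{a<..b} = insert (Suc a) {Suc a<..b}" using \<open>a < b\<close> by auto
  have notin: "Suc a \<notin> {Suc a<..b}" by simp
  show "partition_on {a<..b} (adjoin (Suc a) b ?K)"
    unfolding eq by (rule partition_on_adjoin[OF partition_on_complement notin])
  have ends: "unseparated \<sigma> (Suc a) b"
    unfolding unseparated_def
  proof (intro ballI)
    fix A x y assume "A \<in> \<sigma>" "x \<in> A" "y \<in> A"
    then have "x \<in> {Suc a<..b}" "y \<in> {Suc a<..b}" using partition_onD1[OF \<sigma>] by auto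
    then show "(Suc a < x \<longleftrightarrow> b < x) \<longleftrightarrow> (Suc a < y \<longleftrightarrow> b < y)" by auto
  qed
  have Kb: "block ?K b = {j \<in> {Suc a<..b}. unseparated \<sigma> b j}"
  proof (cases "b = Suc a")
    case True
    then show ?thesis using block_outside[OF partition_on_complement, of b "Suc a" b \<sigma>] by simp
  next
    case False
    then show ?thesis using \<open>a < b\<close> by (intro block_complement) auto
  qed
  fix i assume i: "i \<in> {a<..b}"
  have L: "block (complement a b \<sigma>) i = {j \<in> {a<..b}. unseparated \<sigma> i j}"
    by (rule block_complement[OF i])
  show "block (complement a b \<sigma>) i = block (adjoin (Suc a) b ?K) i"
  proof (cases "i = Suc a \<or> i \<in> block ?K b")
    case True
    then have bi: "unseparated \<sigma> b i" using ends unseparated_sym Kb by auto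
    have "unseparated \<sigma> i j \<longleftrightarrow> unseparated \<sigma> b j" for j
      using bi unseparated_sym unseparated_trans by blast
    moreover have "unseparated \<sigma> b (Suc a)" using ends by (rule unseparated_sym)
    ultimately have "{j \<in> {a<..b}. unseparated \<sigma> i j} = insert (Suc a) (block ?K b)"
      unfolding Kb eq by auto
    with True L show ?thesis
      unfolding block_adjoin[OF partition_on_complement notin] by simp
  next
    case False
    then have i': "i \<in> {Suc a<..b}" using i by auto
    have "\<not> unseparated \<sigma> i (Suc a)"
    proof
      assume "unseparated \<sigma> i (Suc a)"
      with ends have "unseparated \<sigma> b i" using unseparated_sym unseparated_trans by blast
      with False i' Kb show False by simp
    qed
    then have "{j \<in> {a<..b}. unseparated \<sigma> i j} = {j \<in> {Suc a<..b}. unseparated \<sigma> i j}"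
      unfolding eq by auto
    with False L show ?thesis
      unfolding block_adjoin[OF partition_on_complement notin]
      by (simp add: block_complement[OF i'])
  qed
qed

lemma complement_insert_singleton: "complement a b (insert {x} \<sigma>) = complement a b \<sigma>"
proof -
  have "unseparated (insert {x} \<sigma>) i j = unseparated \<sigma> i j" for i j
    by (simp add: unseparated_def)
  then show ?thesis by (simp add: complement_def)
qed

text \<open>
  The case of the decomposition in which the first point is isolated.
\<close>

lemma bij_betw_insert_singleton:
  assumes "a < b"
  shows "bij_betw (insert {Suc a}) (NCI (Suc a) b) {\<pi> \<in> NCI a b. {Suc a} \<in> \<pi>}"
proof (rule bij_betwI[of _ _ _ "\<lambda>\<pi>. \<pi> - {{Suc a}}"])
  have eq: "{a<..b} = insert (Suc a) {Suc a<..b}" using \<open>a < b\<close> by auto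
  have notin: "{Suc a} \<notin> \<sigma>" if "\<sigma> \<in> NCI (Suc a) b" for \<sigma>
  proof
    assume "{Suc a} \<in> \<sigma>"
    then have "Suc a \<in> \<Union>\<sigma>" by auto
    also have "\<Union>\<sigma> = {Suc a<..b}" using that partition_onD1 by (auto simp: NCI_def)
    finally show False by simp
  qed
  show "insert {Suc a} \<in> NCI (Suc a) b \<rightarrow> {\<pi> \<in> NCI a b. {Suc a} \<in> \<pi>}"
  proof
    fix \<sigma> assume \<sigma>: "\<sigma> \<in> NCI (Suc a) b"
    then have p: "partition_on {Suc a<..b} \<sigma>" and n: "noncrossing \<sigma>" by (auto simp: NCI_def)
    have "partition_on ({Suc a} \<union> {Suc a<..b}) ({{Suc a}} \<union> \<sigma>)"
      by (intro partition_on_Un p partition_on_space) auto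
    moreover have "noncrossing (insert {Suc a} \<sigma>)"
    proof (rule noncrossingI)
      fix A B x y z w
      assume *: "A \<in> insert {Suc a} \<sigma>" "B \<in> insert {Suc a} \<sigma>" "x \<in> A" "y \<in> B" "z \<in> A" "w \<in> B"
        and o: "x < y" "y < z" "z < w"
      then have "A \<noteq> {Suc a}" "B \<noteq> {Suc a}" by auto
      with * show "A = B" by (intro noncrossingD[OF n _ _ _ _ _ _ o]) auto
    qed
    ultimately show "insert {Suc a} \<sigma> \<in> {\<pi> \<in> NCI a b. {Suc a} \<in> \<pi>}"
      by (simp add: NCI_def eq)
  qed
  show "(\<lambda>\<pi>. \<pi> - {{Suc a}}) \<in> {\<pi> \<in> NCI a b. {Suc a} \<in> \<pi>} \<rightarrow> NCI (Suc a) b"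
  proof
    fix \<pi> assume "\<pi> \<in> {\<pi> \<in> NCI a b. {Suc a} \<in> \<pi>}"
    then have p: "partition_on {a<..b} \<pi>" and n: "noncrossing \<pi>" and S: "{Suc a} \<in> \<pi>"
      by (auto simp: NCI_def)
    have "disjnt {Suc a} (\<Union>(\<pi> - {{Suc a}}))"
      using S pairwiseD[OF partition_onD2[OF p], of "{Suc a}"] by auto
    moreover have "insert {Suc a} (\<pi> - {{Suc a}}) = \<pi>" using S by auto
    ultimately have "partition_on ({a<..b} - {Suc a}) (\<pi> - {{Suc a}})"
      using p partition_on_insert[of "{Suc a}" "\<pi> - {{Suc a}}" "{a<..b}"] by metis
    moreover have "{a<..b} - {Suc a} = {Suc a<..b}" by auto
    moreover have "noncrossing (\<pi> - {{Suc a}})"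
      by (rule noncrossing_embed[OF n, of _ id]) auto
    ultimately show "\<pi> - {{Suc a}} \<in> NCI (Suc a) b" by (simp add: NCI_def)
  qed
qed (use assms in \<open>auto simp: NCI_def partition_on_def\<close>)

text \<open>
  The first point \<open>Suc a\<close> is put into the block of \<open>Suc k\<close> in \<open>\<tau>\<close>, and \<open>\<sigma>\<close> fills the gap between these
  two points.
\<close>

definition glue :: "nat \<Rightarrow> nat \<Rightarrow> nat set set \<Rightarrow> nat set set \<Rightarrow> nat set set" where
  "glue a k \<sigma> \<tau> = \<sigma> \<union> adjoin (Suc a) (Suc k) \<tau>"

context
  fixes a k b :: nat and \<sigma> \<tau> :: "nat set set"
  assumes ak: "a < k" and kb: "k < b"
    and \<sigma>: "partition_on {Suc a<..k} \<sigma>" and \<tau>: "partition_on {k<..b} \<tau>"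
begin

lemma glue_endpoints: "Suc a \<notin> {k<..b}" "Suc k \<in> {k<..b}"
  using ak kb by auto

lemma glue_pieces:
  "partition_on (insert (Suc a) {k<..b}) (adjoin (Suc a) (Suc k) \<tau>)"
  "{Suc a<..k} \<inter> insert (Suc a) {k<..b} = {}"
  using partition_on_adjoin[OF \<tau> glue_endpoints(1)] by auto

lemma partition_on_glue: "partition_on {a<..b} (glue a k \<sigma> \<tau>)"
proof -
  have "{a<..b} = {Suc a<..k} \<union> insert (Suc a) {k<..b}" using ak kb by auto
  then show ?thesis
    unfolding glue_def using partition_on_Un[OF \<sigma> glue_pieces] by simp
qed

lemma glued_block: "block \<tau> (Suc k) \<in> \<tau>" "Suc k \<in> block \<tau> (Suc k)" "block \<tau> (Suc k) \<subseteq> {k<..b}"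
  using block_in[OF \<tau> glue_endpoints(2)] block_self[OF \<tau> glue_endpoints(2)] block_subset[OF \<tau>] by auto

lemma glue_left_subset: "A \<in> \<sigma> \<Longrightarrow> A \<subseteq> {Suc a<..k}"
  using partition_onD1[OF \<sigma>] by auto

lemma glue_right_subset: "A \<in> \<tau> \<Longrightarrow> A \<subseteq> {k<..b}"
  using partition_onD1[OF \<tau>] by auto

text \<open>
  A case split on the origin of a block, together with the position of its points.
\<close>

lemma glue_cases:
  assumes "A \<in> glue a k \<sigma> \<tau>"
  obtains (left) "A \<in> \<sigma>" "A \<subseteq> {Suc a<..k}"
  | (right) "A \<in> \<tau>" "A \<noteq> block \<tau> (Suc k)" "A \<subseteq> {k<..b}" "Suc k \<notin> A"
  | (first) "A = insert (Suc a) (block \<tau> (Suc k))"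
proof -
  have "Suc k \<notin> A" if "A \<in> \<tau>" "A \<noteq> block \<tau> (Suc k)"
    using block_eq[OF \<tau>, of A "Suc k"] that by auto
  moreover have "A \<in> \<sigma> \<or> A \<in> \<tau> \<and> A \<noteq> block \<tau> (Suc k) \<or> A = insert (Suc a) (block \<tau> (Suc k))"
    using assms by (auto simp: glue_def adjoin_def)
  ultimately show ?thesis using that glue_left_subset glue_right_subset by blast
qed

text \<open>
  In a crossing that involves the new point, the latter can only be the first of the four points. It may then
  be replaced by \<open>Suc k\<close>, which lies in the same block, so the crossing is already present in \<open>\<tau>\<close>.
\<close>

lemma noncrossing_glue:
  assumes ns: "noncrossing \<sigma>" and nt: "noncrossing \<tau>"
  shows "noncrossing (glue a k \<sigma> \<tau>)"
proof (rule noncrossingI)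
  let ?U = "block \<tau> (Suc k)"
  note U = glued_block
  fix A B x y z w
  assume AB: "A \<in> glue a k \<sigma> \<tau>" "B \<in> glue a k \<sigma> \<tau>"
    and xyzw: "x \<in> A" "y \<in> B" "z \<in> A" "w \<in> B" and o: "x < y" "y < z" "z < w"
  show "A = B"
    using AB(1)
  proof (cases rule: glue_cases)
    case A: left
    then have "Suc a < x" "z \<le> k" using xyzw by auto
    then have y: "Suc a < y" "y \<le> k" using o by auto
    have "B \<in> \<sigma>"
      using AB(2)
    proof (cases rule: glue_cases)
      case right then show ?thesis using y xyzw by auto
    next
      case first then show ?thesis using y xyzw U(3) by auto
    qed
    then show ?thesis by (rule noncrossingD[OF ns A(1) _ xyzw o])
  next
    case A: right
    then have "k < x" using xyzw by auto
    then have y: "k < y" "k < w" using o by auto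
    show ?thesis
      using AB(2)
    proof (cases rule: glue_cases)
      case left then show ?thesis using y xyzw by auto
    next
      case right then show ?thesis by (intro noncrossingD[OF nt A(1) _ xyzw o])
    next
      case first
      then have "y \<in> ?U" "w \<in> ?U" using xyzw y ak by auto
      then have "A = ?U" using xyzw by (intro noncrossingD[OF nt A(1) U(1) _ _ _ _ o])
      with A show ?thesis by simp
    qed
  next
    case A: first
    show ?thesis
      using AB(2)
    proof (cases rule: glue_cases)
      case left
      then have "Suc a < y" "w \<le> k" using xyzw by auto
      then have "Suc a < z" "z \<le> k" using o by auto
      then show ?thesis using A xyzw U(3) by auto
    next
      case B: right
      then have "k < y" "y \<noteq> Suc k" using xyzw by auto
      then have y: "Suc k < y" by simp
      then have "z \<in> ?U" using A xyzw o ak by auto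
      moreover obtain x' where "x' \<in> ?U" "x' < y"
        using y U(2) by blast
      ultimately have "?U = B" using xyzw o by (intro noncrossingD[OF nt U(1) B(1), of x' y z w])
      with B show ?thesis by simp
    next
      case first with A show ?thesis by simp
    qed
  qed
qed

lemma unseparated_glue_right:
  assumes "i \<in> {k<..b}" "j \<in> {k<..b}"
  shows "unseparated (glue a k \<sigma> \<tau>) i j \<longleftrightarrow> unseparated \<tau> i j"
proof
  assume L: "unseparated (glue a k \<sigma> \<tau>) i j"
  show "unseparated \<tau> i j"
    unfolding unseparated_def
  proof (intro ballI)
    fix A x y assume A: "A \<in> \<tau>" "x \<in> A" "y \<in> A"
    have "\<exists>A'\<in>glue a k \<sigma> \<tau>. x \<in> A' \<and> y \<in> A'"
      using A by (cases "A = block \<tau> (Suc k)") (auto simp: glue_def adjoin_def)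
    then show "(i < x \<longleftrightarrow> j < x) \<longleftrightarrow> (i < y \<longleftrightarrow> j < y)"
      using unseparatedD[OF L] by blast
  qed
next
  assume R: "unseparated \<tau> i j"
  show "unseparated (glue a k \<sigma> \<tau>) i j"
    unfolding unseparated_def
  proof (intro ballI)
    fix A x y assume A: "A \<in> glue a k \<sigma> \<tau>" and xy: "x \<in> A" "y \<in> A"
    show "(i < x \<longleftrightarrow> j < x) \<longleftrightarrow> (i < y \<longleftrightarrow> j < y)"
      using A
    proof (cases rule: glue_cases)
      case left
      then have "x \<le> k" "y \<le> k" using xy by auto
      then show ?thesis using assms by auto
    next
      case right then show ?thesis using unseparatedD[OF R _ xy] by blast
    next
      case first
      have *: "i < z \<longleftrightarrow> j < z" if "z \<in> A" for z
      proof (cases "z = Suc a")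
        case True then show ?thesis using assms ak by auto
      next
        case False
        then have "z \<in> block \<tau> (Suc k)" using that first by auto
        from unseparatedD[OF R glued_block(1) this glued_block(2)] show ?thesis
          using assms by auto
      qed
      show ?thesis using *[OF xy(1)] *[OF xy(2)] by blast
    qed
  qed
qed

lemma unseparated_glue_left:
  assumes "i \<in> {a<..k}" "j \<in> {a<..k}"
  shows "unseparated (glue a k \<sigma> \<tau>) i j \<longleftrightarrow> unseparated \<sigma> i j"
proof
  assume L: "unseparated (glue a k \<sigma> \<tau>) i j"
  show "unseparated \<sigma> i j"
    unfolding unseparated_def
  proof (intro ballI)
    fix A x y assume "A \<in> \<sigma>" "x \<in> A" "y \<in> A"
    then show "(i < x \<longleftrightarrow> j < x) \<longleftrightarrow> (i < y \<longleftrightarrow> j < y)"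
      by (intro unseparatedD[OF L]) (auto simp: glue_def)
  qed
next
  assume R: "unseparated \<sigma> i j"
  show "unseparated (glue a k \<sigma> \<tau>) i j"
    unfolding unseparated_def
  proof (intro ballI)
    fix A x y assume A: "A \<in> glue a k \<sigma> \<tau>" and xy: "x \<in> A" "y \<in> A"
    have *: "i < z \<longleftrightarrow> j < z" if "z = Suc a \<or> k < z" for z
      using that assms by auto
    show "(i < x \<longleftrightarrow> j < x) \<longleftrightarrow> (i < y \<longleftrightarrow> j < y)"
      using A
    proof (cases rule: glue_cases)
      case left then show ?thesis using unseparatedD[OF R _ xy] by blast
    next
      case right
      then have "k < x" "k < y" using xy by auto
      then show ?thesis using * by blast
    next
      case first
      then have "x = Suc a \<or> k < x" "y = Suc a \<or> k < y" using xy glued_block(3) by auto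
      then show ?thesis using * by blast
    qed
  qed
qed

text \<open>
  The block through \<open>Suc a\<close> and \<open>Suc k\<close> separates the bars in the gap from those behind it.
\<close>

lemma separated_glue:
  assumes "i \<in> {a<..k}" "j \<in> {k<..b}"
  shows "\<not> unseparated (glue a k \<sigma> \<tau>) i j"
proof
  assume "unseparated (glue a k \<sigma> \<tau>) i j"
  moreover have "insert (Suc a) (block \<tau> (Suc k)) \<in> glue a k \<sigma> \<tau>" by (simp add: glue_def adjoin_def)
  ultimately have "(i < Suc a \<longleftrightarrow> j < Suc a) \<longleftrightarrow> (i < Suc k \<longleftrightarrow> j < Suc k)"
    by (rule unseparatedD) (use glued_block(2) in auto)
  then show False using assms ak by auto
qed

text \<open>
  Bars up to \<open>k\<close> see only \<open>\<sigma>\<close>, bars after \<open>k\<close> see only \<open>\<tau>\<close>, and the two groups are separated. Hence the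
  complement is a union, in which \<open>\<tau>\<close> alone determines the block of the last point.
\<close>

lemma complement_glue:
  "complement a b (glue a k \<sigma> \<tau>) =
     adjoin (Suc a) k (complement (Suc a) k \<sigma>) \<union> complement k b \<tau>"
proof -
  let ?\<pi> = "glue a k \<sigma> \<tau>"
  have eq: "{a<..k} \<union> {k<..b} = {a<..b}" "{a<..k} \<inter> {k<..b} = {}" using ak kb by auto
  note Un = partition_on_complement[of a k \<sigma>] partition_on_complement[of k b \<tau>] eq(2)
  have "complement a b ?\<pi> = complement a k \<sigma> \<union> complement k b \<tau>"
  proof (rule partition_eqI[OF partition_on_complement])
    show "partition_on {a<..b} (complement a k \<sigma> \<union> complement k b \<tau>)"
      using partition_on_Un[OF Un] by (simp only: eq)
    fix i assume i: "i \<in> {a<..b}"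
    show "block (complement a b ?\<pi>) i = block (complement a k \<sigma> \<union> complement k b \<tau>) i"
    proof (cases "i \<in> {a<..k}")
      case True
      have "{j \<in> {a<..b}. unseparated ?\<pi> i j} = {j \<in> {a<..k}. unseparated \<sigma> i j}"
        unfolding eq(1)[symmetric]
        using unseparated_glue_left[OF True] separated_glue[OF True] by blast
      with True show ?thesis
        by (simp add: block_Un[OF Un] block_complement[OF i] block_complement[OF True])
    next
      case False
      then have i': "i \<in> {k<..b}" using i by auto
      have "{j \<in> {a<..b}. unseparated ?\<pi> i j} = {j \<in> {k<..b}. unseparated \<tau> i j}"
        unfolding eq(1)[symmetric]
        using unseparated_glue_right[OF i'] separated_glue[OF _ i'] unseparated_sym by blast
      with False show ?thesis
        unfolding block_Un[OF Un] block_complement[OF i] block_complement[OF i'] by (simp only: if_False)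
    qed
  qed
  then show ?thesis unfolding adjoin_complement[OF \<sigma> ak] .
qed

end

text \<open>
  The inverse of gluing: the next element of the first block ends the gap, the blocks inside the gap
  form one part, and the remaining blocks, the first block being deprived of its first point, form
  the other.
\<close>

definition rest_of_first :: "nat \<Rightarrow> nat set set \<Rightarrow> nat set" where
  "rest_of_first a \<pi> = block \<pi> (Suc a) - {Suc a}"

definition gap_end :: "nat \<Rightarrow> nat set set \<Rightarrow> nat" where
  "gap_end a \<pi> = Min (rest_of_first a \<pi>) - 1"

definition gap_blocks :: "nat \<Rightarrow> nat set set \<Rightarrow> nat set set" where
  "gap_blocks a \<pi> = {A \<in> \<pi>. A \<subseteq> {Suc a<..gap_end a \<pi>}}"

definition tail_blocks :: "nat \<Rightarrow> nat \<Rightarrow> nat set set \<Rightarrow> nat set set" where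
  "tail_blocks a b \<pi> = {A \<in> \<pi>. A \<subseteq> {gap_end a \<pi><..b}}"

context
  fixes a b :: nat and \<pi> :: "nat set set"
  assumes \<pi>: "partition_on {a<..b} \<pi>" and nc: "noncrossing \<pi>"
    and ab: "a < b" and not_isolated: "{Suc a} \<notin> \<pi>"
begin

abbreviation "first_rest \<equiv> rest_of_first a \<pi>"
abbreviation "split_point \<equiv> gap_end a \<pi>"

lemma first_block: "block \<pi> (Suc a) \<in> \<pi>" "Suc a \<in> block \<pi> (Suc a)" "block \<pi> (Suc a) = insert (Suc a) first_rest"
proof -
  have "Suc a \<in> {a<..b}" using ab by auto
  then show "block \<pi> (Suc a) \<in> \<pi>" and *: "Suc a \<in> block \<pi> (Suc a)"
    using block_in[OF \<pi>] block_self[OF \<pi>] by blast+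
  show "block \<pi> (Suc a) = insert (Suc a) first_rest"
    unfolding rest_of_first_def using * by blast
qed

lemma first_rest_properties: "first_rest \<noteq> {}" "finite first_rest" "first_rest \<subseteq> {Suc a<..b}" "first_rest \<notin> \<pi>"
proof -
  show ne: "first_rest \<noteq> {}" using not_isolated first_block(1,3) by metis
  show sub: "first_rest \<subseteq> {Suc a<..b}"
    using block_subset[OF \<pi>, of "Suc a"] by (auto simp: rest_of_first_def)
  then show "finite first_rest" by (rule finite_subset) simp
  show "first_rest \<notin> \<pi>"
  proof
    assume A: "first_rest \<in> \<pi>"
    obtain x where x: "x \<in> first_rest" using ne by auto
    then have "block \<pi> x = first_rest" by (rule block_eq[OF \<pi> A])
    moreover have "block \<pi> x = block \<pi> (Suc a)"
      by (rule block_eq[OF \<pi> first_block(1)]) (use x in \<open>simp add: rest_of_first_def\<close>)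
    ultimately have "Suc a \<in> first_rest" using first_block(2) by metis
    then show False by (simp add: rest_of_first_def)
  qed
qed

lemma split_point: "a < split_point" "split_point < b" "Suc split_point \<in> first_rest"
  "first_rest \<subseteq> {split_point<..b}"
proof -
  have M: "Min first_rest \<in> first_rest" using first_rest_properties by simp
  then have "Suc a < Min first_rest" "Min first_rest \<le> b" using first_rest_properties(3) by auto
  moreover from this have "Suc split_point = Min first_rest" by (simp add: gap_end_def)
  ultimately show "a < split_point" "split_point < b" "Suc split_point \<in> first_rest"
    using M by auto
  show "first_rest \<subseteq> {split_point<..b}"
  proof
    fix x assume x: "x \<in> first_rest"
    then have "Suc split_point \<le> x" using \<open>Suc split_point = _\<close> first_rest_properties(2) by simp
    with x show "x \<in> {split_point<..b}" using first_rest_properties(3) by auto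
  qed
qed

abbreviation "gap_part \<equiv> gap_blocks a \<pi>"
abbreviation "tail_rest \<equiv> tail_blocks a b \<pi>"

text \<open>
  A block with points in the gap and points behind it would cross the first block.
\<close>

lemma split_cases:
  assumes "A \<in> \<pi>" "A \<noteq> block \<pi> (Suc a)"
  shows "A \<in> gap_part \<or> A \<in> tail_rest"
proof (rule ccontr)
  assume "\<not> ?thesis"
  then have not: "\<not> A \<subseteq> {Suc a<..split_point}" "\<not> A \<subseteq> {split_point<..b}"
    using assms(1) by (auto simp: gap_blocks_def tail_blocks_def)
  have disj: "x \<notin> A" if "x \<in> block \<pi> (Suc a)" for x
  proof
    assume "x \<in> A"
    then show False
      using block_eq[OF \<pi> assms(1)] block_eq[OF \<pi> first_block(1) that] assms(2) by simp
  qed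
  have sub: "A \<subseteq> {a<..b}" using partition_onD1[OF \<pi>] assms(1) by auto
  obtain x y where xy: "x \<in> A" "y \<in> A" "x \<notin> {split_point<..b}" "y \<notin> {Suc a<..split_point}"
    using not by blast
  have "x \<noteq> Suc a" "y \<noteq> Suc a" "y \<noteq> Suc split_point"
    using xy disj first_block(2,3) split_point(3) by auto
  moreover have "x \<in> {a<..b}" "y \<in> {a<..b}" using sub xy by auto
  ultimately have o: "Suc a < x" "x < Suc split_point" "Suc split_point < y"
    using xy by auto
  have "block \<pi> (Suc a) = A"
    using first_block split_point(3) xy by (intro noncrossingD[OF nc _ assms(1) _ _ _ _ o]) auto
  with assms(2) show False by simp
qed

lemma partition_gap_part: "partition_on {Suc a<..split_point} gap_part"
proof (rule partition_onI)
  have "{Suc a<..split_point} \<subseteq> \<Union>gap_part"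
  proof
    fix x assume x: "x \<in> {Suc a<..split_point}"
    then have "x \<in> {a<..b}" using split_point by auto
    then have B: "block \<pi> x \<in> \<pi>" "x \<in> block \<pi> x"
      using block_in[OF \<pi>] block_self[OF \<pi>] by auto
    have "x \<notin> block \<pi> (Suc a)" using x split_point(4) unfolding first_block(3) by auto
    with B have "block \<pi> x \<in> gap_part \<or> block \<pi> x \<in> tail_rest" by (intro split_cases) auto
    moreover have "block \<pi> x \<notin> tail_rest" using B x by (auto simp: tail_blocks_def)
    ultimately show "x \<in> \<Union>gap_part" using B by auto
  qed
  then show "\<Union>gap_part = {Suc a<..split_point}" by (auto simp: gap_blocks_def)
  show "disjnt p q" if "p \<in> gap_part" "q \<in> gap_part" "p \<noteq> q" for p q
    using that pairwiseD[OF partition_onD2[OF \<pi>]] by (auto simp: gap_blocks_def)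
qed (use partition_onD3[OF \<pi>] in \<open>auto simp: gap_blocks_def\<close>)

lemma partition_tail: "partition_on {split_point<..b} (insert first_rest tail_rest)"
proof (rule partition_onI)
  have "{split_point<..b} \<subseteq> \<Union>(insert first_rest tail_rest)"
  proof
    fix x assume x: "x \<in> {split_point<..b}"
    then have "x \<in> {a<..b}" using split_point by auto
    then have B: "block \<pi> x \<in> \<pi>" "x \<in> block \<pi> x"
      using block_in[OF \<pi>] block_self[OF \<pi>] by auto
    show "x \<in> \<Union>(insert first_rest tail_rest)"
    proof (cases "block \<pi> x = block \<pi> (Suc a)")
      case True
      then have "x \<in> insert (Suc a) first_rest" using B first_block(3) by simp
      then show ?thesis using x split_point(1) by auto
    next
      case False
      with B have "block \<pi> x \<in> gap_part \<or> block \<pi> x \<in> tail_rest" by (intro split_cases) auto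
      moreover have "block \<pi> x \<notin> gap_part" using B x by (auto simp: gap_blocks_def)
      ultimately show ?thesis using B by auto
    qed
  qed
  then show "\<Union>(insert first_rest tail_rest) = {split_point<..b}"
    using split_point(4) by (auto simp: tail_blocks_def)
  have fr: "disjnt first_rest q" if "q \<in> tail_rest" for q
  proof -
    have q: "q \<in> \<pi>" "Suc a \<notin> q" using that split_point(1) by (auto simp: tail_blocks_def)
    then have "q \<noteq> block \<pi> (Suc a)" using first_block(2) by auto
    then have "disjnt (block \<pi> (Suc a)) q"
      using pairwiseD[OF partition_onD2[OF \<pi>] first_block(1) q(1)] by auto
    then show ?thesis by (auto simp: rest_of_first_def disjnt_def)
  qed
  have rr: "disjnt p q" if "p \<in> tail_rest" "q \<in> tail_rest" "p \<noteq> q" for p q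
    using that pairwiseD[OF partition_onD2[OF \<pi>]] by (auto simp: tail_blocks_def)
  show "disjnt p q" if pq: "p \<in> insert first_rest tail_rest" "q \<in> insert first_rest tail_rest" "p \<noteq> q" for p q
  proof -
    consider "p = first_rest" "q \<in> tail_rest" | "q = first_rest" "p \<in> tail_rest" | "p \<in> tail_rest" "q \<in> tail_rest"
      using pq by blast
    then show ?thesis
      by cases (use fr[of q] fr[of p, THEN disjnt_sym] rr[OF _ _ \<open>p \<noteq> q\<close>] in simp_all)
  qed
qed (use partition_onD3[OF \<pi>] first_rest_properties in \<open>auto simp: tail_blocks_def\<close>)

lemma noncrossing_gap_part: "noncrossing gap_part"
  by (rule noncrossing_embed[OF nc, of _ id]) (auto simp: gap_blocks_def)

lemma noncrossing_tail: "noncrossing (insert first_rest tail_rest)"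
proof (rule noncrossing_embed[OF nc, of _ "\<lambda>A. if A = first_rest then block \<pi> (Suc a) else A"])
  have V: "block \<pi> (Suc a) \<notin> tail_rest"
    using first_block(2) split_point(1) by (auto simp: tail_blocks_def)
  show "inj_on (\<lambda>A. if A = first_rest then block \<pi> (Suc a) else A) (insert first_rest tail_rest)"
  proof (rule inj_onI)
    fix A B assume AB: "A \<in> insert first_rest tail_rest" "B \<in> insert first_rest tail_rest"
      and eq: "(if A = first_rest then block \<pi> (Suc a) else A) =
        (if B = first_rest then block \<pi> (Suc a) else B)"
    show "A = B"
      using AB eq V by (cases "A = first_rest"; cases "B = first_rest") simp_all
  qed
  fix A assume "A \<in> insert first_rest tail_rest"
  then show "A \<subseteq> (if A = first_rest then block \<pi> (Suc a) else A) \<and>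
      (if A = first_rest then block \<pi> (Suc a) else A) \<in> \<pi>"
    using first_block(1) by (auto simp: tail_blocks_def rest_of_first_def)
qed

lemma glue_split: "glue a split_point gap_part (insert first_rest tail_rest) = \<pi>"
proof -
  have U: "block (insert first_rest tail_rest) (Suc split_point) = first_rest"
    by (rule block_eq[OF partition_tail _ split_point(3)]) simp
  have "first_rest \<notin> tail_rest" using first_rest_properties(4) by (auto simp: tail_blocks_def)
  then have "adjoin (Suc a) (Suc split_point) (insert first_rest tail_rest) =
      insert (block \<pi> (Suc a)) tail_rest"
    unfolding adjoin_def U first_block(3) by auto
  moreover have "gap_part \<union> insert (block \<pi> (Suc a)) tail_rest = \<pi>"
  proof
    show "gap_part \<union> insert (block \<pi> (Suc a)) tail_rest \<subseteq> \<pi>"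
      using first_block(1) by (auto simp: gap_blocks_def tail_blocks_def)
    show "\<pi> \<subseteq> gap_part \<union> insert (block \<pi> (Suc a)) tail_rest"
      using split_cases by blast
  qed
  ultimately show ?thesis by (simp add: glue_def)
qed

end

text \<open>
  Together with \<open>glue_split\<close> this makes gluing a bijection onto the noncrossing partitions whose first
  point is not isolated.
\<close>

lemma split_glue:
  assumes ak: "a < k" and kb: "k < b"
    and \<sigma>: "partition_on {Suc a<..k} \<sigma>" and \<tau>: "partition_on {k<..b} \<tau>"
  defines "\<pi> \<equiv> glue a k \<sigma> \<tau>"
  shows "{Suc a} \<notin> \<pi>" "gap_end a \<pi> = k" "gap_blocks a \<pi> = \<sigma>"
    "insert (rest_of_first a \<pi>) (tail_blocks a b \<pi>) = \<tau>"
proof -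
  let ?U = "block \<tau> (Suc k)"
  note \<pi> = partition_on_glue[OF ak kb \<sigma> \<tau>, folded \<pi>_def]
  note U = glued_block[OF ak kb \<sigma> \<tau>]
  note cases = glue_cases[OF ak kb \<sigma> \<tau>, folded \<pi>_def, consumes 1, case_names left right first]
  have V: "insert (Suc a) ?U \<in> \<pi>" by (simp add: \<pi>_def glue_def adjoin_def)
  have Vb: "block \<pi> (Suc a) = insert (Suc a) ?U" by (rule block_eq[OF \<pi> V]) simp
  have "{Suc a} = block \<pi> (Suc a)" if "{Suc a} \<in> \<pi>"
    using block_eq[OF \<pi> that] by simp
  then show "{Suc a} \<notin> \<pi>" unfolding Vb using U(2) ak by auto
  have "Suc a \<notin> ?U" using U(3) ak by auto
  then have fr: "rest_of_first a \<pi> = ?U" unfolding rest_of_first_def Vb by auto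
  have "Min ?U = Suc k"
    using U finite_subset[OF U(3)] by (intro Min_eqI) auto
  then show sp: "gap_end a \<pi> = k" by (simp add: gap_end_def fr)
  have ne: "A \<noteq> {}" if "A \<in> \<pi>" for A using that partition_onD3[OF \<pi>] by auto
  show "gap_blocks a \<pi> = \<sigma>"
  proof
    show "\<sigma> \<subseteq> gap_blocks a \<pi>"
    proof
      fix A assume "A \<in> \<sigma>"
      moreover from this have "A \<in> \<pi>" by (simp add: \<pi>_def glue_def)
      ultimately show "A \<in> gap_blocks a \<pi>"
        using glue_left_subset[OF ak kb \<sigma> \<tau>, of A] unfolding gap_blocks_def sp by simp
    qed
    show "gap_blocks a \<pi> \<subseteq> \<sigma>"
    proof
      fix A assume "A \<in> gap_blocks a \<pi>"
      then have A: "A \<in> \<pi>" "A \<subseteq> {Suc a<..k}" by (auto simp: gap_blocks_def sp)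
      from A(1) show "A \<in> \<sigma>"
      proof (cases rule: cases)
        case right
        obtain x where "x \<in> A" using ne[OF A(1)] by auto
        then have "x \<le> k" "k < x" using A right by auto
        then show ?thesis by simp
      next
        case first
        then have "Suc a \<in> A" by simp
        then show ?thesis using A(2) by auto
      qed
    qed
  qed
  have "tail_blocks a b \<pi> = \<tau> - {?U}"
  proof
    show "\<tau> - {?U} \<subseteq> tail_blocks a b \<pi>"
    proof
      fix A assume "A \<in> \<tau> - {?U}"
      moreover from this have "A \<in> \<pi>" by (simp add: \<pi>_def glue_def adjoin_def)
      ultimately show "A \<in> tail_blocks a b \<pi>"
        using glue_right_subset[OF ak kb \<sigma> \<tau>, of A] unfolding tail_blocks_def sp by simp
    qed
    show "tail_blocks a b \<pi> \<subseteq> \<tau> - {?U}"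
    proof
      fix A assume "A \<in> tail_blocks a b \<pi>"
      then have A: "A \<in> \<pi>" "A \<subseteq> {k<..b}" by (auto simp: tail_blocks_def sp)
      from A(1) show "A \<in> \<tau> - {?U}"
      proof (cases rule: cases)
        case left
        obtain x where "x \<in> A" using ne[OF A(1)] by auto
        then have "x \<le> k" "k < x" using A left by auto
        then show ?thesis by simp
      next
        case first
        then have "Suc a \<in> A" by simp
        then show ?thesis using A(2) ak by auto
      qed simp
    qed
  qed
  then show "insert (rest_of_first a \<pi>) (tail_blocks a b \<pi>) = \<tau>" unfolding fr using U(1) by auto
qed

section \<open>Weighted sums over noncrossing partitions\<close>

text \<open>
  The block of \<open>x\<close> is weighted by \<open>h\<close> and every other block by \<open>f\<close>. For \<open>x\<close> outside the partitioned set
  the factor \<open>h 0\<close> remains.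
\<close>

definition weight :: "(nat \<Rightarrow> 'a) \<Rightarrow> (nat \<Rightarrow> 'a) \<Rightarrow> 'i set set \<Rightarrow> 'i \<Rightarrow> 'a::comm_ring_1" where
  "weight h f \<pi> x = h (card (block \<pi> x)) * (\<Prod>A\<in>\<pi> - {block \<pi> x}. f (card A))"

text \<open>
  Enlarging a block by one point shifts the weight of the marked block. This is the reason for
  admitting a separate weight function there.
\<close>

lemma weight_adjoin:
  assumes P: "partition_on S P" and "finite S" and x: "x \<notin> S" and z: "z = x \<or> z \<in> block P y"
  shows "weight h f (adjoin x y P) z = weight (h \<circ> Suc) f P y"
proof -
  let ?U = "block P y"
  have "block (adjoin x y P) z = insert x ?U"
    using z by (simp add: block_adjoin[OF P x])
  moreover have "x \<notin> ?U" "finite ?U"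
    using block_subset[OF P, of y] x \<open>finite S\<close> finite_subset by blast+
  moreover have "insert x ?U \<notin> P"
    using x partition_onD1[OF P] by auto
  then have "adjoin x y P - {insert x ?U} = P - {?U}"
    by (auto simp: adjoin_def)
  ultimately show ?thesis by (simp add: weight_def)
qed

lemma weight_Un:
  assumes P: "partition_on S P" and Q: "partition_on T Q" and ST: "S \<inter> T = {}"
    and fin: "finite S" "finite T" and z: "z \<notin> S"
  shows "weight h f (P \<union> Q) z = (\<Prod>A\<in>P. f (card A)) * weight h f Q z"
proof -
  have "block (P \<union> Q) z = block Q z"
    using z by (simp add: block_Un[OF P Q ST])
  moreover have "block Q z \<notin> P"
  proof
    assume B: "block Q z \<in> P"
    then have "block Q z \<subseteq> S" using partition_onD1[OF P] by auto
    then have "block Q z = {}" using block_subset[OF Q, of z] ST by auto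
    with B partition_onD3[OF P] show False by simp
  qed
  then have "P \<union> Q - {block Q z} = P \<union> (Q - {block Q z})" by auto
  moreover have "P \<inter> (Q - {block Q z}) = {}"
  proof (rule equals0I)
    fix A assume "A \<in> P \<inter> (Q - {block Q z})"
    then have "A \<subseteq> S" "A \<subseteq> T" "A \<noteq> {}"
      using partition_onD1[OF P] partition_onD1[OF Q] partition_onD3[OF P] by auto
    with ST show False by auto
  qed
  then have "(\<Prod>A\<in>P \<union> (Q - {block Q z}). f (card A)) =
      (\<Prod>A\<in>P. f (card A)) * (\<Prod>A\<in>Q - {block Q z}. f (card A))"
    by (intro prod.union_disjoint) (use finite_elements[OF _ P] finite_elements[OF _ Q] fin in auto)
  ultimately show ?thesis by (simp add: weight_def ac_simps)
qed

lemma weight_self: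
  assumes P: "partition_on S P" "finite S" and x: "x \<in> S \<or> f 0 = 1"
  shows "weight f f P x = (\<Prod>A\<in>P. f (card A))"
proof (cases "x \<in> S")
  case True
  show ?thesis
    unfolding weight_def
    using prod.remove[OF finite_elements[OF P(2,1)] block_in[OF P(1) True], of "\<lambda>A. f (card A)"] by simp
next
  case False
  then have "block P x = {}" by (rule block_outside[OF P(1)])
  moreover have "P - {{}} = P" using partition_onD3[OF P(1)] by auto
  ultimately show ?thesis using x False by (simp add: weight_def)
qed

text \<open>
  For \<open>h1 = f\<close> and \<open>h2 = g\<close> this is a coefficient of the boxed convolution. The recursion shifts the weights
  of the two marked blocks, so it needs them as independent parameters.
\<close>

definition NC_sum :: "(nat \<Rightarrow> 'a) \<Rightarrow> (nat \<Rightarrow> 'a) \<Rightarrow> (nat \<Rightarrow> 'a) \<Rightarrow> (nat \<Rightarrow> 'a) \<Rightarrow> nat \<Rightarrow> nat \<Rightarrow> 'a::comm_ring_1" where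
  "NC_sum f g h1 h2 a b = (\<Sum>\<pi>\<in>NCI a b. weight h1 f \<pi> (Suc a) * weight h2 g (complement a b \<pi>) b)"

lemma finite_NCI: "finite (NCI a b)"
  by (rule finite_subset[OF _ finitely_many_partition_on[of "{a<..b}"]]) (auto simp: NCI_def)

lemma weight_complement_adjoin:
  assumes "a < b" "partition_on {Suc a<..b} \<sigma>"
  shows "weight h g (complement a b \<sigma>) b = weight (h \<circ> Suc) g (complement (Suc a) b \<sigma>) b"
proof -
  have "b = Suc a \<or> b \<in> block (complement (Suc a) b \<sigma>) b"
    using assms(1) by (cases "b = Suc a") (auto intro: block_self[OF partition_on_complement])
  then show ?thesis
    unfolding adjoin_complement[OF assms(2,1)]
    by (intro weight_adjoin[OF partition_on_complement]) auto
qed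

lemma weight_isolated:
  assumes "a < b" "\<sigma> \<in> NCI (Suc a) b" and f0: "f 0 = 1"
  shows "weight h1 f (insert {Suc a} \<sigma>) (Suc a) * weight h2 g (complement a b (insert {Suc a} \<sigma>)) b =
    h1 1 * (weight f f \<sigma> (Suc (Suc a)) * weight (h2 \<circ> Suc) g (complement (Suc a) b \<sigma>) b)"
proof -
  have \<sigma>: "partition_on {Suc a<..b} \<sigma>" using assms(2) by (simp add: NCI_def)
  have "weight h1 f (\<sigma> \<union> {{Suc a}}) (Suc a) = (\<Prod>A\<in>\<sigma>. f (card A)) * weight h1 f {{Suc a}} (Suc a)"
    by (rule weight_Un[OF \<sigma> partition_on_space]) auto
  moreover have "weight h1 f {{Suc a}} (Suc a) = h1 1"
    by (simp add: weight_def block_def)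
  moreover have "weight f f \<sigma> (Suc (Suc a)) = (\<Prod>A\<in>\<sigma>. f (card A))"
    by (rule weight_self[OF \<sigma>]) (use f0 in auto)
  ultimately show ?thesis
    by (simp add: complement_insert_singleton weight_complement_adjoin[OF assms(1) \<sigma>])
qed

lemma weight_glue:
  assumes ak: "a < k" and kb: "k < b" and "\<sigma> \<in> NCI (Suc a) k" "\<tau> \<in> NCI k b" and f0: "f 0 = 1"
  shows "weight h1 f (glue a k \<sigma> \<tau>) (Suc a) * weight h2 g (complement a b (glue a k \<sigma> \<tau>)) b =
    (weight f f \<sigma> (Suc (Suc a)) * weight (g \<circ> Suc) g (complement (Suc a) k \<sigma>) k) *
    (weight (h1 \<circ> Suc) f \<tau> (Suc k) * weight h2 g (complement k b \<tau>) b)"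
proof -
  have \<sigma>: "partition_on {Suc a<..k} \<sigma>" and \<tau>: "partition_on {k<..b} \<tau>"
    using assms by (simp_all add: NCI_def)
  note pieces = glue_pieces[OF ak kb \<sigma> \<tau>] and notin = glue_endpoints[OF ak kb \<sigma> \<tau>]
  have "weight h1 f (glue a k \<sigma> \<tau>) (Suc a) =
      (\<Prod>A\<in>\<sigma>. f (card A)) * weight h1 f (adjoin (Suc a) (Suc k) \<tau>) (Suc a)"
    unfolding glue_def by (rule weight_Un[OF \<sigma> pieces]) auto
  also have "weight h1 f (adjoin (Suc a) (Suc k) \<tau>) (Suc a) = weight (h1 \<circ> Suc) f \<tau> (Suc k)"
    by (rule weight_adjoin[OF \<tau> _ notin(1)]) auto
  also have "(\<Prod>A\<in>\<sigma>. f (card A)) = weight f f \<sigma> (Suc (Suc a))"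
    by (rule weight_self[OF \<sigma>, symmetric]) (use f0 in auto)
  finally have 1: "weight h1 f (glue a k \<sigma> \<tau>) (Suc a) =
    weight f f \<sigma> (Suc (Suc a)) * weight (h1 \<circ> Suc) f \<tau> (Suc k)" .
  have "complement a b (glue a k \<sigma> \<tau>) = complement a k \<sigma> \<union> complement k b \<tau>"
    unfolding complement_glue[OF ak kb \<sigma> \<tau>] adjoin_complement[OF \<sigma> ak] ..
  then have "weight h2 g (complement a b (glue a k \<sigma> \<tau>)) b =
      (\<Prod>A\<in>complement a k \<sigma>. g (card A)) * weight h2 g (complement k b \<tau>) b"
    using kb by (simp only:) (rule weight_Un[OF partition_on_complement partition_on_complement]; auto)
  also have "(\<Prod>A\<in>complement a k \<sigma>. g (card A)) = weight g g (complement a k \<sigma>) k"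
    by (rule weight_self[OF partition_on_complement, symmetric]) (use ak in auto)
  also have "\<dots> = weight (g \<circ> Suc) g (complement (Suc a) k \<sigma>) k"
    by (rule weight_complement_adjoin[OF ak \<sigma>])
  finally show ?thesis unfolding 1 by (simp only: ac_simps)
qed

text \<open>
  The first summand collects the partitions in which the first point is isolated, and the sum runs over
  the end \<open>k\<close> of the gap in all others. The bar of \<open>Suc a\<close> enlarges the complementary block of the last
  point of what follows it, which is the marked block in the former case (\<open>h2 \<circ> Suc\<close>) and an ordinary
  block of the gap in the latter (\<open>g \<circ> Suc\<close>). The normalisation \<open>f 0 = 1\<close> takes care of empty gaps.
\<close>

theorem NC_sum_rec:
  assumes ab: "a < b" and f0: "f 0 = 1"
  shows "NC_sum f g h1 h2 a b = h1 1 * NC_sum f g f (h2 \<circ> Suc) (Suc a) b +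
    (\<Sum>k\<in>{a<..<b}. NC_sum f g f (g \<circ> Suc) (Suc a) k * NC_sum f g (h1 \<circ> Suc) h2 k b)"
proof -
  let ?w = "\<lambda>\<pi>. weight h1 f \<pi> (Suc a) * weight h2 g (complement a b \<pi>) b"
  let ?I = "{\<pi> \<in> NCI a b. {Suc a} \<in> \<pi>}" and ?J = "{\<pi> \<in> NCI a b. {Suc a} \<notin> \<pi>}"
  let ?v = "\<lambda>h1 h2 a b \<pi>. weight h1 f \<pi> (Suc a) * weight h2 g (complement a b \<pi>) b"
  have "NC_sum f g h1 h2 a b = sum ?w ?I + sum ?w ?J"
    unfolding NC_sum_def
    by (subst sum.union_disjoint[symmetric]) (auto intro!: sum.cong simp: finite_NCI)
  also have "sum ?w ?I = (\<Sum>\<sigma>\<in>NCI (Suc a) b. ?w (insert {Suc a} \<sigma>))"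
    by (rule sum.reindex_bij_betw[OF bij_betw_insert_singleton[OF ab], symmetric])
  also have "\<dots> = h1 1 * NC_sum f g f (h2 \<circ> Suc) (Suc a) b"
    unfolding NC_sum_def sum_distrib_left
    by (intro sum.cong refl weight_isolated[where f = f, OF ab _ f0])
  also have "sum ?w ?J = (\<Sum>(k, \<sigma>, \<tau>)\<in>Sigma {a<..<b} (\<lambda>k. NCI (Suc a) k \<times> NCI k b).
      ?v f (g \<circ> Suc) (Suc a) k \<sigma> * ?v (h1 \<circ> Suc) h2 k b \<tau>)"
  proof (rule sum.reindex_bij_witness[where
        i = "\<lambda>(k, \<sigma>, \<tau>). glue a k \<sigma> \<tau>" and
        j = "\<lambda>\<pi>. (gap_end a \<pi>, gap_blocks a \<pi>, insert (rest_of_first a \<pi>) (tail_blocks a b \<pi>))"])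
    fix \<pi> assume "\<pi> \<in> ?J"
    then have \<pi>: "partition_on {a<..b} \<pi>" "noncrossing \<pi>" "a < b" "{Suc a} \<notin> \<pi>"
      using ab by (simp_all add: NCI_def)
    let ?k = "gap_end a \<pi>" and ?\<sigma> = "gap_blocks a \<pi>" and ?\<tau> = "insert (rest_of_first a \<pi>) (tail_blocks a b \<pi>)"
    have k: "a < ?k" "?k < b" using split_point(1,2)[OF \<pi>] by auto
    have \<sigma>\<tau>: "?\<sigma> \<in> NCI (Suc a) ?k" "?\<tau> \<in> NCI ?k b"
      using partition_gap_part[OF \<pi>] partition_tail[OF \<pi>]
        noncrossing_gap_part[OF \<pi>] noncrossing_tail[OF \<pi>] by (simp_all add: NCI_def)
    show eq: "(case (?k, ?\<sigma>, ?\<tau>) of (k, \<sigma>, \<tau>) \<Rightarrow> glue a k \<sigma> \<tau>) = \<pi>"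
      using glue_split[OF \<pi>] by simp
    show "(?k, ?\<sigma>, ?\<tau>) \<in> Sigma {a<..<b} (\<lambda>k. NCI (Suc a) k \<times> NCI k b)"
      using k \<sigma>\<tau> by simp
    show "(case (?k, ?\<sigma>, ?\<tau>) of (k, \<sigma>, \<tau>) \<Rightarrow> ?v f (g \<circ> Suc) (Suc a) k \<sigma> * ?v (h1 \<circ> Suc) h2 k b \<tau>) = ?w \<pi>"
      using weight_glue[where f = f, OF k \<sigma>\<tau> f0, of h1 h2 g] unfolding glue_split[OF \<pi>] by simp
  next
    fix t assume "t \<in> Sigma {a<..<b} (\<lambda>k. NCI (Suc a) k \<times> NCI k b)"
    then obtain k \<sigma> \<tau> where t: "t = (k, \<sigma>, \<tau>)" and k: "a < k" "k < b"
      and \<sigma>: "partition_on {Suc a<..k} \<sigma>" "noncrossing \<sigma>" and \<tau>: "partition_on {k<..b} \<tau>" "noncrossing \<tau>"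
      by (auto simp: NCI_def)
    note * = split_glue[OF k \<sigma>(1) \<tau>(1)]
    show "(gap_end a (case t of (k, \<sigma>, \<tau>) \<Rightarrow> glue a k \<sigma> \<tau>), gap_blocks a (case t of (k, \<sigma>, \<tau>) \<Rightarrow> glue a k \<sigma> \<tau>),
        insert (rest_of_first a (case t of (k, \<sigma>, \<tau>) \<Rightarrow> glue a k \<sigma> \<tau>)) (tail_blocks a b (case t of (k, \<sigma>, \<tau>) \<Rightarrow> glue a k \<sigma> \<tau>))) = t"
      using * by (simp add: t)
    show "(case t of (k, \<sigma>, \<tau>) \<Rightarrow> glue a k \<sigma> \<tau>) \<in> ?J"
      using partition_on_glue[OF k \<sigma>(1) \<tau>(1)] noncrossing_glue[OF k \<sigma>(1) \<tau>(1) \<sigma>(2) \<tau>(2)] *(1)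
      by (simp add: t NCI_def)
  qed
  also have "\<dots> = (\<Sum>k\<in>{a<..<b}. \<Sum>p\<in>NCI (Suc a) k \<times> NCI k b.
      ?v f (g \<circ> Suc) (Suc a) k (fst p) * ?v (h1 \<circ> Suc) h2 k b (snd p))"
    by (subst sum.Sigma) (auto simp: finite_NCI case_prod_unfold)
  also have "\<dots> = (\<Sum>k\<in>{a<..<b}. NC_sum f g f (g \<circ> Suc) (Suc a) k * NC_sum f g (h1 \<circ> Suc) h2 k b)"
    unfolding NC_sum_def sum_product sum.cartesian_product
    by (simp only: case_prod_unfold)
  finally show ?thesis .
qed

section \<open>Maximality of the explicit complement\<close>

text \<open>
  Two crossing complementary blocks would have unions of blocks \<open>{x<..z}\<close> and \<open>{y<..w}\<close> with
  \<open>x < y < z < w\<close>; then \<open>{x<..y}\<close>, the difference of the former and the latter, is a union of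
  blocks as well, so all four bars lie in a single block.
\<close>

lemma noncrossing_interleave_complement:
  assumes \<pi>: "noncrossing \<pi>"
  shows "noncrossing (interleave \<pi> (complement 0 n \<pi>))"
proof (rule noncrossingI)
  let ?\<kappa> = "complement 0 n \<pi>"
  fix A B x y z w
  assume AB: "A \<in> interleave \<pi> ?\<kappa>" "B \<in> interleave \<pi> ?\<kappa>"
    and xyzw: "x \<in> A" "y \<in> B" "z \<in> A" "w \<in> B" and o: "x < y" "y < z" "z < w"
  have un: "unseparated \<pi> i j" if "W \<in> ?\<kappa>" "i \<in> W" "j \<in> W" for W i j
  proof -
    have "W = block ?\<kappa> i" using block_eq[OF partition_on_complement that(1,2)] by simp
    moreover have "i \<in> {0<..n}" using that(1,2) partition_onD1[OF partition_on_complement, of 0 n \<pi>] by auto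
    ultimately show ?thesis using that(3) block_complement[of i 0 n \<pi>] by simp
  qed
  consider (VV) V V' where "V \<in> \<pi>" "V' \<in> \<pi>" "A = (\<lambda>i. 2 * i) ` V" "B = (\<lambda>i. 2 * i) ` V'"
    | (VW) V W where "V \<in> \<pi>" "W \<in> ?\<kappa>" "A = (\<lambda>i. 2 * i) ` V" "B = (\<lambda>i. 2 * i + 1) ` W"
    | (WV) W V where "V \<in> \<pi>" "W \<in> ?\<kappa>" "A = (\<lambda>i. 2 * i + 1) ` W" "B = (\<lambda>i. 2 * i) ` V"
    | (WW) W W' where "W \<in> ?\<kappa>" "W' \<in> ?\<kappa>" "A = (\<lambda>i. 2 * i + 1) ` W" "B = (\<lambda>i. 2 * i + 1) ` W'"
    using AB unfolding interleave_def by blast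
  then show "A = B"
  proof cases
    case VV
    then obtain x' y' z' w' where "x' \<in> V" "y' \<in> V'" "z' \<in> V" "w' \<in> V'" "x = 2*x'" "y = 2*y'" "z = 2*z'" "w = 2*w'"
      using xyzw by blast
    then have "V = V'" using VV o by (intro noncrossingD[OF \<pi>, of V V' x' y' z' w']) auto
    with VV show ?thesis by simp
  next
    case VW
    then obtain x' y' z' w' where v: "x' \<in> V" "y' \<in> W" "z' \<in> V" "w' \<in> W"
      and e: "x = 2*x'" "y = 2*y'+1" "z = 2*z'" "w = 2*w'+1"
      using xyzw by blast
    have "(y' < x' \<longleftrightarrow> w' < x') \<longleftrightarrow> (y' < z' \<longleftrightarrow> w' < z')"
      using VW v by (intro unseparatedD[OF un]) 
    moreover have "x' \<le> y'" "y' < z'" "z' \<le> w'" using o e by linarith+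
    ultimately show ?thesis by auto
  next
    case WV
    then obtain x' y' z' w' where v: "x' \<in> W" "y' \<in> V" "z' \<in> W" "w' \<in> V"
      and e: "x = 2*x'+1" "y = 2*y'" "z = 2*z'+1" "w = 2*w'"
      using xyzw by blast
    have "(x' < y' \<longleftrightarrow> z' < y') \<longleftrightarrow> (x' < w' \<longleftrightarrow> z' < w')"
      using WV v by (intro unseparatedD[OF un])
    moreover have "x' < y'" "y' \<le> z'" "z' < w'" using o e by linarith+
    ultimately show ?thesis by auto
  next
    case WW
    then obtain x' y' z' w' where v: "x' \<in> W" "y' \<in> W'" "z' \<in> W" "w' \<in> W'"
      and e: "x = 2*x'+1" "y = 2*y'+1" "z = 2*z'+1" "w = 2*w'+1"
      using xyzw by blast
    have o': "x' < y'" "y' < z'" "z' < w'" using o e by linarith+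
    have "unseparated \<pi> x' y'"
      unfolding unseparated_def
    proof (intro ballI)
      fix V i j assume V: "V \<in> \<pi>" "i \<in> V" "j \<in> V"
      have "(x' < i \<longleftrightarrow> z' < i) \<longleftrightarrow> (x' < j \<longleftrightarrow> z' < j)" "(y' < i \<longleftrightarrow> w' < i) \<longleftrightarrow> (y' < j \<longleftrightarrow> w' < j)"
        using unseparatedD[OF un[OF WW(1) v(1,3)] V] unseparatedD[OF un[OF WW(2) v(2,4)] V] by blast+
      then show "(x' < i \<longleftrightarrow> y' < i) \<longleftrightarrow> (x' < j \<longleftrightarrow> y' < j)"
        using o' by linarith
    qed
    moreover have "x' \<in> {0<..n}" "y' \<in> {0<..n}"
      using WW v partition_onD1[OF partition_on_complement, of 0 n \<pi>] by auto
    ultimately have "y' \<in> block ?\<kappa> x'" by (simp add: block_complement)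
    then have "y' \<in> W" using block_eq[OF partition_on_complement WW(1) v(1)] by simp
    then have "W = W'"
      using block_eq[OF partition_on_complement WW(1)] block_eq[OF partition_on_complement WW(2) v(2)] by metis
    with WW show ?thesis by simp
  qed
qed

text \<open>
  If some block of \<open>\<pi>\<close> leads from \<open>{i<..j}\<close> to the outside, then it crosses every block containing the
  bars of \<open>i\<close> and \<open>j\<close>.
\<close>

lemma interleave_refines_complement:
  assumes \<pi>: "partition_on {0<..n} \<pi>" and \<tau>: "partition_on {0<..n} \<tau>"
    and nc: "noncrossing (interleave \<pi> \<tau>)"
  shows "refines {0<..n} \<tau> (complement 0 n \<pi>)"
proof -
  have key: False if W: "W \<in> \<tau>" "i \<in> W" "j \<in> W" and V: "V \<in> \<pi>" "u \<in> V" "v \<in> V"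
    and "i < u" "u \<le> j" and v: "v \<le> i \<or> j < v" for i j u v V W
  proof -
    let ?A = "(\<lambda>i. 2 * i) ` V" and ?B = "(\<lambda>i. 2 * i + 1) ` W"
    have mem: "?A \<in> interleave \<pi> \<tau>" "?B \<in> interleave \<pi> \<tau>" using V W by (auto simp: interleave_def)
    have pts: "2 * u \<in> ?A" "2 * v \<in> ?A" "2 * i + 1 \<in> ?B" "2 * j + 1 \<in> ?B" using V W by auto
    have "?A = ?B"
    proof (cases "v \<le> i")
      case True
      then show ?thesis
        using that by (intro noncrossingD[OF nc mem pts(2,3,1,4)]) auto
    next
      case False
      then have "?B = ?A"
        using that by (intro noncrossingD[OF nc mem(2,1) pts(3,1,4,2)]) auto
      then show ?thesis by simp
    qed
    then have "2 * u \<in> ?B" using pts by simp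
    then show False by (auto simp: image_iff) presburger
  qed
  have "\<exists>q\<in>complement 0 n \<pi>. p \<subseteq> q" if p: "p \<in> \<tau>" for p
  proof -
    obtain i where i: "i \<in> p" using p partition_onD3[OF \<tau>] by (cases "p = {}") auto
    have sub: "p \<subseteq> {0<..n}" using p partition_onD1[OF \<tau>] by auto
    have un: "unseparated \<pi> i j" if j: "j \<in> p" for j
      unfolding unseparated_def
    proof (intro ballI)
      fix V u v assume V: "V \<in> \<pi>" "u \<in> V" "v \<in> V"
      show "(i < u \<longleftrightarrow> j < u) \<longleftrightarrow> (i < v \<longleftrightarrow> j < v)"
        using key[OF p i j V] key[OF p i j V(1,3,2)] key[OF p j i V] key[OF p j i V(1,3,2)] by (metis linorder_not_le)
    qed
    have "p \<subseteq> {j \<in> {0<..n}. unseparated \<pi> i j}" using sub un by auto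
    moreover have "{j \<in> {0<..n}. unseparated \<pi> i j} \<in> complement 0 n \<pi>"
      using i sub by (auto simp: complement_def)
    ultimately show ?thesis by blast
  qed
  then show ?thesis unfolding refines_def using \<tau> partition_on_complement by blast
qed

lemma kreweras_eq_complement:
  assumes "\<pi> \<in> NC n"
  shows "kreweras n \<pi> = complement 0 n \<pi>"
proof -
  have eq: "{1..n} = {0<..n}" by auto
  have \<pi>: "partition_on {0<..n} \<pi>" "noncrossing \<pi>" using assms unfolding NC_def eq by auto
  note nc = noncrossing_interleave_complement[OF \<pi>(2), of n]
  show ?thesis
    unfolding kreweras_def eq
  proof (rule the_equality, intro conjI allI impI)
    show "refines {0<..n} \<tau> (complement 0 n \<pi>)"
      if "partition_on {0<..n} \<tau> \<and> noncrossing (interleave \<pi> \<tau>)" for \<tau>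
      using that by (intro interleave_refines_complement[OF \<pi>(1)]) auto
    fix \<sigma> assume \<sigma>: "partition_on {0<..n} \<sigma> \<and> noncrossing (interleave \<pi> \<sigma>) \<and>
        (\<forall>\<tau>. partition_on {0<..n} \<tau> \<and> noncrossing (interleave \<pi> \<tau>) \<longrightarrow> refines {0<..n} \<tau> \<sigma>)"
    then have "refines {0<..n} (complement 0 n \<pi>) \<sigma>" using nc partition_on_complement by blast
    moreover have "refines {0<..n} \<sigma> (complement 0 n \<pi>)"
      using \<sigma> by (intro interleave_refines_complement[OF \<pi>(1)]) auto
    ultimately show "\<sigma> = complement 0 n \<pi>" by (rule refines_asym[rotated])
  qed (rule partition_on_complement nc)+
qed

section \<open>Composition of power series over commutative rings\<close>

lemma fps_mult_compose_nth:
  fixes A :: "'a::comm_ring_1 fps"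
  assumes A: "A $ 0 = 0"
  shows "(b * (a oo A)) $ n = (\<Sum>k=0..n. a $ k * (b * A ^ k) $ n)"
proof -
  have "(a oo A) $ m = (\<Sum>k=0..n. a $ k * (A ^ k) $ m)" if "m \<le> n" for m
    unfolding fps_compose_nth
    by (rule sum.mono_neutral_left) (use that startsby_zero_power_prefix[OF A] in auto)
  then have "(b * (a oo A)) $ n = (\<Sum>j=0..n. b $ j * (\<Sum>k=0..n. a $ k * (A ^ k) $ (n - j)))"
    by (simp add: fps_mult_nth)
  also have "\<dots> = (\<Sum>k=0..n. \<Sum>j=0..n. a $ k * (b $ j * (A ^ k) $ (n - j)))"
    unfolding sum_distrib_left by (subst sum.swap) (simp add: ac_simps)
  finally show ?thesis by (simp add: fps_mult_nth sum_distrib_left)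
qed

text \<open>
  Horner's scheme: composition is determined by this equation and compatible with taking off the
  constant term. All laws of composition are derived from it by means of \<open>fps_eq_zero_of_shift\<close>, which
  works over rings with zero divisors.
\<close>

lemma fps_compose_unfold:
  fixes A :: "'a::comm_ring_1 fps"
  assumes A: "A $ 0 = 0"
  shows "a oo A = fps_const (a $ 0) + A * (fps_shift 1 a oo A)"
proof (rule fps_ext)
  fix n
  have "(a oo A) $ n = (\<Sum>k=0..Suc n. a $ k * (A ^ k) $ n)"
    unfolding fps_compose_nth
    by (rule sum.mono_neutral_left) (use startsby_zero_power_prefix[OF A] in auto)
  also have "\<dots> = a $ 0 * (A ^ 0) $ n + (\<Sum>k=0..n. a $ Suc k * (A ^ Suc k) $ n)"
    by (subst sum.atLeast0_atMost_Suc_shift) simp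
  also have "(\<Sum>k=0..n. a $ Suc k * (A ^ Suc k) $ n) = (A * (fps_shift 1 a oo A)) $ n"
    unfolding fps_mult_compose_nth[OF A] by simp
  finally show "(a oo A) $ n = (fps_const (a $ 0) + A * (fps_shift 1 a oo A)) $ n"
    by (cases n) simp_all
qed

text \<open>
  Iterating the hypothesis, \<open>D a\<close> is divisible by every power of \<open>A\<close>. Identities between
  expressions in \<open>a\<close> are obtained by taking their difference for \<open>D\<close>. The parameter \<open>a\<close> ranges over
  power series with \<open>\<sigma>\<close> their shift, and later over weight functions.
\<close>

lemma fps_eq_zero_of_shift:
  fixes A :: "'a::comm_ring_1 fps" and D :: "'b \<Rightarrow> 'a fps"
  assumes A: "A $ 0 = 0" and D: "\<And>a. D a = A * D (\<sigma> a)"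
  shows "D a = 0"
proof -
  have "D a $ n = 0" for n
  proof (induction n arbitrary: a rule: less_induct)
    case (less n)
    have "A $ i * D (\<sigma> a) $ (n - i) = 0" if "i \<le> n" for i
      using A less[of "n - i" "\<sigma> a"] that by (cases "i = 0") auto
    then have "(A * D (\<sigma> a)) $ n = 0" by (simp add: fps_mult_nth)
    then show ?case using D[of a] by simp
  qed
  then show ?thesis by (simp add: fps_eq_iff)
qed

lemma fps_decompose: "a = fps_const (a $ 0) + fps_X * fps_shift 1 (a :: 'a::comm_ring_1 fps)"
  by (rule fps_ext) (auto simp: fps_X_mult_nth)

lemma fps_compose_X_mult:
  fixes A :: "'a::comm_ring_1 fps"
  assumes A: "A $ 0 = 0"
  shows "(fps_X * a) oo A = A * (a oo A)"
proof -
  have "fps_shift 1 (fps_X * a) = a" by (rule fps_ext) simp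
  then show ?thesis using fps_compose_unfold[OF A, of "fps_X * a"] by simp
qed

lemma fps_compose_mult:
  fixes A :: "'a::comm_ring_1 fps"
  assumes A: "A $ 0 = 0"
  shows "(a * b) oo A = (a oo A) * (b oo A)"
proof -
  have "((a * b) oo A) - (a oo A) * (b oo A) = 0"
  proof (rule fps_eq_zero_of_shift[OF A, of "\<lambda>a. ((a * b) oo A) - (a oo A) * (b oo A)" "fps_shift 1"])
    fix a :: "'a fps"
    let ?s = "fps_shift 1 a"
    have "a * b = fps_const (a $ 0) * b + fps_X * (?s * b)"
      by (subst fps_decompose[of a]) (simp only: algebra_simps)
    then have "(a * b) oo A = fps_const (a $ 0) * (b oo A) + A * ((?s * b) oo A)"
      by (simp only: fps_compose_add_distrib fps_compose_X_mult[OF A] fps_const_mult_apply_left)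
    then show "((a * b) oo A) - (a oo A) * (b oo A) = A * (((?s * b) oo A) - (?s oo A) * (b oo A))"
      by (simp add: fps_compose_unfold[OF A, of a] algebra_simps)
  qed
  then show ?thesis by simp
qed

lemma fps_compose_chain_rule:
  fixes A :: "'a::comm_ring_1 fps"
  assumes A: "A $ 0 = 0"
  shows "fps_deriv (a oo A) = (fps_deriv a oo A) * fps_deriv A"
proof -
  have "fps_deriv (a oo A) - (fps_deriv a oo A) * fps_deriv A = 0"
  proof (rule fps_eq_zero_of_shift[OF A, of "\<lambda>a. fps_deriv (a oo A) - (fps_deriv a oo A) * fps_deriv A" "fps_shift 1"])
    fix a :: "'a fps"
    let ?s = "fps_shift 1 a"
    have "fps_deriv a = ?s + fps_X * fps_deriv ?s"
      by (subst fps_decompose[of a]) (simp add: algebra_simps)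
    then have 1: "fps_deriv a oo A = (?s oo A) + A * (fps_deriv ?s oo A)"
      by (simp only: fps_compose_add_distrib fps_compose_X_mult[OF A])
    show "fps_deriv (a oo A) - (fps_deriv a oo A) * fps_deriv A =
        A * (fps_deriv (?s oo A) - (fps_deriv ?s oo A) * fps_deriv A)"
      unfolding 1 by (subst fps_compose_unfold[OF A, of a]) (simp add: algebra_simps)
  qed
  then show ?thesis by simp
qed

lemma fps_compose_associative:
  fixes A :: "'a::comm_ring_1 fps"
  assumes A: "A $ 0 = 0" and f: "f $ 0 = 0"
  shows "a oo (f oo A) = (a oo f) oo A"
proof -
  have fA: "(f oo A) $ 0 = 0" using f by simp
  have "(a oo (f oo A)) - ((a oo f) oo A) = 0"
  proof (rule fps_eq_zero_of_shift[OF fA, of "\<lambda>a. (a oo (f oo A)) - ((a oo f) oo A)" "fps_shift 1"])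
    fix a :: "'a fps"
    let ?s = "fps_shift 1 a"
    have "(a oo f) oo A = fps_const (a $ 0) + (f oo A) * ((?s oo f) oo A)"
      by (subst fps_compose_unfold[OF f, of a])
        (simp add: fps_compose_add_distrib fps_compose_mult[OF A])
    then show "(a oo (f oo A)) - ((a oo f) oo A) = (f oo A) * ((?s oo (f oo A)) - ((?s oo f) oo A))"
      by (simp add: fps_compose_unfold[OF fA, of a] algebra_simps)
  qed
  then show ?thesis by simp
qed

text \<open>
  \<open>P\<close> is the variable times a series with constant term \<open>1\<close>, hence not a zero divisor in any ring.
\<close>

lemma fps_mult_left_cancel_order_1:
  fixes P :: "'a::comm_ring_1 fps"
  assumes P: "P $ 0 = 0" "P $ 1 = 1" and eq: "P * Y = P * Z"
  shows "Y = Z"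
proof -
  have "(Y - Z) $ n = 0" for n
  proof (induction n rule: less_induct)
    case (less n)
    have "(\<Sum>i=0..Suc n. P $ i * (Y - Z) $ (Suc n - i)) = (\<Sum>i\<in>{1}. P $ i * (Y - Z) $ (Suc n - i))"
    proof (rule sum.mono_neutral_right)
      show "\<forall>i\<in>{0..Suc n} - {1}. P $ i * (Y - Z) $ (Suc n - i) = 0"
      proof
        fix i assume i: "i \<in> {0..Suc n} - {1}"
        show "P $ i * (Y - Z) $ (Suc n - i) = 0"
        proof (cases "i = 0")
          case False
          with i have "Suc n - i < n" by auto
          then show ?thesis using less by simp
        qed (simp add: P)
      qed
    qed auto
    moreover have "P * (Y - Z) = 0" using eq by (simp add: algebra_simps)
    then have "(P * (Y - Z)) $ Suc n = 0" by simp
    ultimately show ?case using P by (simp add: fps_mult_nth)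
  qed
  then show ?thesis by (simp add: fps_eq_iff)
qed

lemma fps_compose_right_cancel:
  fixes P :: "'a::comm_ring_1 fps"
  assumes P: "P $ 0 = 0" "P $ 1 = 1" and eq: "a oo P = b oo P"
  shows "a = b"
proof -
  have "(a - b) $ n = 0" for n
  proof (induction n rule: less_induct)
    case (less n)
    have "((a - b) oo P) $ n = (\<Sum>i\<in>{n}. (a - b) $ i * (P ^ i) $ n)"
      unfolding fps_compose_nth by (rule sum.mono_neutral_right) (use less in auto)
    moreover have "(a - b) oo P = 0" using eq by (simp add: fps_compose_sub_distrib)
    ultimately show ?case using P(2) by (simp add: startsby_zero_power_nth_same[OF P(1)])
  qed
  then show ?thesis by (simp add: fps_eq_iff)
qed

section \<open>Functional equations of the boxed convolution\<close>

lemma NC_sum_empty: "NC_sum f g h1 h2 a a = h1 0 * h2 0"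
proof -
  have "NCI a a = {{}}" by (auto simp: NCI_def partition_on_empty noncrossing_def)
  then show ?thesis by (simp add: NC_sum_def weight_def block_def complement_def)
qed

text \<open>
  The recursion determines the sums and only involves the lengths of intervals.
\<close>

lemma NC_sum_translate:
  assumes f0: "f 0 = 1"
  shows "a \<le> b \<Longrightarrow> NC_sum f g h1 h2 a b = NC_sum f g h1 h2 0 (b - a)"
proof (induction "b - a" arbitrary: a b h1 h2 rule: less_induct)
  case less
  show ?case
  proof (cases "a = b")
    case True
    then show ?thesis by (simp add: NC_sum_empty)
  next
    case False
    with less.prems have ab: "a < b" by simp
    have IH: "NC_sum f g h h' c d = NC_sum f g h h' c' d'"
      if "c \<le> d" "c' \<le> d'" "d - c = d' - c'" "d - c < b - a" for h h' c d c' d'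
      using less.hyps[of d c h h'] less.hyps[of d' c' h h'] that by simp
    have "NC_sum f g h1 h2 a b = h1 1 * NC_sum f g f (h2 \<circ> Suc) (Suc a) b +
      (\<Sum>k\<in>{a<..<b}. NC_sum f g f (g \<circ> Suc) (Suc a) k * NC_sum f g (h1 \<circ> Suc) h2 k b)"
      by (rule NC_sum_rec[where f = f, OF ab f0])
    also have "NC_sum f g f (h2 \<circ> Suc) (Suc a) b = NC_sum f g f (h2 \<circ> Suc) (Suc 0) (b - a)"
      using ab by (intro IH) auto
    also have "(\<Sum>k\<in>{a<..<b}. NC_sum f g f (g \<circ> Suc) (Suc a) k * NC_sum f g (h1 \<circ> Suc) h2 k b) =
        (\<Sum>k\<in>{0<..<b - a}. NC_sum f g f (g \<circ> Suc) (Suc 0) k * NC_sum f g (h1 \<circ> Suc) h2 k (b - a))"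
    proof (rule sum.reindex_bij_witness[where i = "\<lambda>k. k + a" and j = "\<lambda>k. k - a"])
      fix k assume "k \<in> {a<..<b}"
      then show "NC_sum f g f (g \<circ> Suc) (Suc 0) (k - a) * NC_sum f g (h1 \<circ> Suc) h2 (k - a) (b - a) =
          NC_sum f g f (g \<circ> Suc) (Suc a) k * NC_sum f g (h1 \<circ> Suc) h2 k b"
        by (intro arg_cong2[where f = "(*)"] IH) auto
    qed auto
    also have "h1 1 * NC_sum f g f (h2 \<circ> Suc) (Suc 0) (b - a) + \<dots> = NC_sum f g h1 h2 0 (b - a)"
      using ab by (intro NC_sum_rec[where f = f, symmetric] f0) simp
    finally show ?thesis .
  qed
qed

text \<open>
  Weights of nonempty blocks, as a power series indexed by the number of points in addition to the
  first one; \<open>fps_X * tail_series h\<close> has the coefficients \<open>h\<close>, except that its constant term is \<open>0\<close>.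
\<close>

definition tail_series :: "(nat \<Rightarrow> 'a) \<Rightarrow> 'a fps" where
  "tail_series h = Abs_fps (\<lambda>m. h (Suc m))"

lemma tail_series_nth_0: "tail_series h $ 0 = h 1"
  by (simp add: tail_series_def)

lemma shift_tail_series: "fps_shift 1 (tail_series h) = tail_series (h \<circ> Suc)"
  by (rule fps_ext) (simp add: tail_series_def)

lemma compose_tail_series:
  fixes A :: "'a::comm_ring_1 fps"
  assumes "A $ 0 = 0"
  shows "tail_series h oo A = fps_const (h 1) + A * (tail_series (h \<circ> Suc) oo A)"
  using fps_compose_unfold[OF assms, of "tail_series h"]
  by (simp only: tail_series_nth_0 shift_tail_series)

context
  fixes f g :: "nat \<Rightarrow> 'a::comm_ring_1"
begin

definition NC_series :: "(nat \<Rightarrow> 'a) \<Rightarrow> (nat \<Rightarrow> 'a) \<Rightarrow> 'a fps" where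
  "NC_series h1 h2 = Abs_fps (\<lambda>n. if n = 0 then 0 else NC_sum f g h1 h2 0 n)"

text \<open>
  The sums over partitions of which the first point is a singleton block of weight \<open>1\<close>. For
  \<open>h2 = g\<close> this is the series \<open>A\<close> with \<open>f \<boxtimes> g = f \<circ> A\<close>, since it also counts the gap following an
  element of a block together with that element.
\<close>

definition isolated_series :: "(nat \<Rightarrow> 'a) \<Rightarrow> 'a fps" where
  "isolated_series h2 = Abs_fps (\<lambda>n. if n = 0 then 0 else NC_sum f g f (h2 \<circ> Suc) 0 (n - 1))"

context
  assumes f0: "f 0 = 1"
begin

lemma isolated_series_nth_0: "isolated_series h2 $ 0 = 0"
  by (simp add: isolated_series_def)

lemma NC_series_unfold:
  "NC_series h1 h2 = fps_const (h1 1) * isolated_series h2 + isolated_series g * NC_series (h1 \<circ> Suc) h2"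
proof (rule fps_ext)
  fix n
  let ?A = "isolated_series g" and ?Q = "NC_series (h1 \<circ> Suc) h2"
  show "NC_series h1 h2 $ n = (fps_const (h1 1) * isolated_series h2 + ?A * ?Q) $ n"
  proof (cases "n = 0")
    case False
    have "(?A * ?Q) $ n = (\<Sum>k=0..n. ?A $ k * ?Q $ (n - k))" by (simp add: fps_mult_nth)
    also have "\<dots> = (\<Sum>k\<in>{0<..<n}. ?A $ k * ?Q $ (n - k))"
    proof (rule sum.mono_neutral_right)
      show "\<forall>k\<in>{0..n} - {0<..<n}. ?A $ k * ?Q $ (n - k) = 0"
      proof
        fix k assume "k \<in> {0..n} - {0<..<n}"
        then have "k = 0 \<or> k = n" by auto
        then show "?A $ k * ?Q $ (n - k) = 0" by (auto simp: isolated_series_def NC_series_def)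
      qed
    qed auto
    also have "\<dots> = (\<Sum>k\<in>{0<..<n}. NC_sum f g f (g \<circ> Suc) (Suc 0) k * NC_sum f g (h1 \<circ> Suc) h2 k n)"
    proof (rule sum.cong[OF refl])
      fix k assume k: "k \<in> {0<..<n}"
      then have "NC_sum f g f (g \<circ> Suc) (Suc 0) k = NC_sum f g f (g \<circ> Suc) 0 (k - 1)"
        using NC_sum_translate[where f = f, OF f0, of "Suc 0" k] by simp
      moreover have "NC_sum f g (h1 \<circ> Suc) h2 k n = NC_sum f g (h1 \<circ> Suc) h2 0 (n - k)"
        using NC_sum_translate[where f = f, OF f0, of k n] k by simp
      ultimately show "?A $ k * ?Q $ (n - k) =
          NC_sum f g f (g \<circ> Suc) (Suc 0) k * NC_sum f g (h1 \<circ> Suc) h2 k n"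
        using k by (simp add: isolated_series_def NC_series_def)
    qed
    finally have "(?A * ?Q) $ n = \<dots>" .
    moreover have "NC_sum f g f (h2 \<circ> Suc) (Suc 0) n = isolated_series h2 $ n"
      using NC_sum_translate[where f = f, OF f0, of "Suc 0" n] False by (simp add: isolated_series_def)
    ultimately show ?thesis
      using False NC_sum_rec[where f = f, of 0 n g h1 h2] f0 by (simp add: NC_series_def)
  qed (simp add: NC_series_def isolated_series_def)
qed

text \<open>
  Solution of the recursion in the weight of the first block: a block with \<open>m\<close> points contributes
  \<open>m - 1\<close> gaps between its elements and the part after its last element.
\<close>

lemma NC_series_eq: "NC_series h1 h2 = (tail_series h1 oo isolated_series g) * isolated_series h2"
proof -
  let ?A = "isolated_series g" and ?C = "isolated_series h2"
  have "NC_series h1 h2 - (tail_series h1 oo ?A) * ?C = 0"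
  proof (rule fps_eq_zero_of_shift[OF isolated_series_nth_0,
        of "\<lambda>h. NC_series h h2 - (tail_series h oo ?A) * ?C" g "\<lambda>h. h \<circ> Suc"])
    fix h
    show "NC_series h h2 - (tail_series h oo ?A) * ?C =
        ?A * (NC_series (h \<circ> Suc) h2 - (tail_series (h \<circ> Suc) oo ?A) * ?C)"
      by (subst NC_series_unfold, subst compose_tail_series[OF isolated_series_nth_0]) (simp add: algebra_simps)
  qed
  then show ?thesis by simp
qed

lemma isolated_series_unfold:
  "isolated_series h2 = fps_X * (fps_const (h2 1) + NC_series f (h2 \<circ> Suc))"
proof (rule fps_ext)
  fix n
  show "isolated_series h2 $ n = (fps_X * (fps_const (h2 1) + NC_series f (h2 \<circ> Suc))) $ n"
    by (cases n; cases "n - 1") (auto simp: isolated_series_def NC_series_def NC_sum_empty f0)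
qed

text \<open>
  Removing the isolated first point and using \<open>NC_series_eq\<close> for the rest yields a recursion in the
  weight of the complementary block of the last point. It has the same form as the one for the first block
  and is solved in the same way.
\<close>

lemma isolated_series_eq:
  defines "B \<equiv> fps_X * (tail_series f oo isolated_series g)"
  shows "isolated_series h2 = fps_X * (tail_series h2 oo B)"
proof -
  have B0: "B $ 0 = 0" by (simp add: B_def)
  have "isolated_series h2 - fps_X * (tail_series h2 oo B) = 0"
  proof (rule fps_eq_zero_of_shift[OF B0,
        of "\<lambda>h. isolated_series h - fps_X * (tail_series h oo B)" "\<lambda>h. h \<circ> Suc"])
    fix h
    have "isolated_series h = fps_X * fps_const (h 1) + B * isolated_series (h \<circ> Suc)"
      unfolding isolated_series_unfold[of h] NC_series_eq by (simp add: B_def algebra_simps)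
    then show "isolated_series h - fps_X * (tail_series h oo B) =
        B * (isolated_series (h \<circ> Suc) - fps_X * (tail_series (h \<circ> Suc) oo B))"
      by (subst compose_tail_series[OF B0]) (simp add: algebra_simps)
  qed
  then show ?thesis by simp
qed

end

end

text \<open>
  Redefining the constant term of \<open>f\<close> to be \<open>1\<close> affects no block, since blocks are nonempty, and meets
  the normalisation of \<open>NC_sum_rec\<close>.
\<close>

lemma boxed_conv_nth:
  fixes f g :: "'a::comm_ring_1 fps"
  assumes n: "n > 0"
  shows "(f \<boxtimes> g) $ n =
    NC_sum (\<lambda>m. if m = 0 then 1 else f $ m) (fps_nth g) (\<lambda>m. if m = 0 then 1 else f $ m) (fps_nth g) 0 n"
proof -
  let ?f = "\<lambda>m. if m = 0 then 1 else f $ m"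
  have eq: "{1..n} = {0<..n}" by auto
  have NC: "NC n = NCI 0 n" unfolding NC_def NCI_def eq ..
  have "X_part f \<pi> * X_part g (kreweras n \<pi>) =
      weight ?f ?f \<pi> (Suc 0) * weight (fps_nth g) (fps_nth g) (complement 0 n \<pi>) n" if "\<pi> \<in> NC n" for \<pi>
  proof -
    have \<pi>: "partition_on {0<..n} \<pi>" using that by (simp add: NC NCI_def)
    have "weight ?f ?f \<pi> (Suc 0) = (\<Prod>A\<in>\<pi>. ?f (card A))"
      by (rule weight_self[OF \<pi>]) simp_all
    also have "\<dots> = X_part f \<pi>"
      unfolding X_part_def
    proof (rule prod.cong[OF refl])
      fix A assume "A \<in> \<pi>"
      then have "A \<noteq> {}" "A \<subseteq> {0<..n}" using partition_onD1[OF \<pi>] partition_onD3[OF \<pi>] by auto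
      then have "card A \<noteq> 0" by (metis card_eq_0_iff finite_greaterThanAtMost finite_subset)
      then show "?f (card A) = f $ card A" by simp
    qed
    finally have "weight ?f ?f \<pi> (Suc 0) = X_part f \<pi>" .
    moreover have "weight (fps_nth g) (fps_nth g) (complement 0 n \<pi>) n = X_part g (complement 0 n \<pi>)"
      unfolding X_part_def by (rule weight_self[OF partition_on_complement]) (use n in auto)
    ultimately show ?thesis by (simp add: kreweras_eq_complement[OF that])
  qed
  then show ?thesis using n by (simp add: boxed_conv_def NC_sum_def NC)
qed

text \<open>
  With \<open>f = z F\<close> and \<open>g = z G\<close>, the previous lemmas give \<open>A = z (G \<circ> B)\<close>, \<open>B = z (F \<circ> A)\<close> and
  \<open>f \<boxtimes> g = (F \<circ> A) A\<close>. So \<open>f \<circ> A = A (F \<circ> A)\<close> is the boxed convolution, \<open>A B\<close> equals \<open>z\<close> times it,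
  and \<open>z (g \<circ> B) = z B (G \<circ> B) = A B\<close> shows that \<open>g \<circ> B\<close> is the same series.
\<close>

theorem boxed_conv_functional_equations:
  fixes f g :: "'a::comm_ring_1 fps"
  assumes f: "f \<in> G1" and g: "g \<in> G1"
  obtains A B where "A $ 0 = 0" "A $ 1 = 1" "B $ 0 = 0"
    "f \<boxtimes> g = f oo A" "f \<boxtimes> g = g oo B" "A * B = fps_X * (f \<boxtimes> g)"
proof -
  define f' where "f' = (\<lambda>m. if m = 0 then 1 else f $ m)"
  define g' where "g' = fps_nth g"
  have f'0: "f' 0 = 1" by (simp add: f'_def)
  define A where "A = isolated_series f' g' g'"
  define B where "B = fps_X * (tail_series f' oo A)"
  have A0: "A $ 0 = 0" unfolding A_def by (rule isolated_series_nth_0[where f = f', OF f'0])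
  have B0: "B $ 0 = 0" by (simp add: B_def)
  have A: "A = fps_X * (tail_series g' oo B)"
    unfolding A_def B_def by (rule isolated_series_eq[where f = f', OF f'0])
  have "f \<boxtimes> g = NC_series f' g' f' g'"
    by (rule fps_ext) (auto simp: NC_series_def boxed_conv_nth f'_def g'_def, simp add: boxed_conv_def)
  then have P: "f \<boxtimes> g = (tail_series f' oo A) * A"
    by (simp only: NC_series_eq[where f = f', OF f'0] A_def)
  have Xf: "fps_X * tail_series f' = f" and Xg: "fps_X * tail_series g' = g"
    using f g by (auto intro!: fps_ext simp: fps_X_mult_nth tail_series_def f'_def g'_def G1_def)
  have 1: "f \<boxtimes> g = f oo A"
    using P fps_compose_X_mult[OF A0, of "tail_series f'"] by (simp only: Xf mult.commute)
  have 2: "A * B = fps_X * (f \<boxtimes> g)"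
    unfolding P B_def by (simp only: ac_simps)
  have "g oo B = B * (tail_series g' oo B)"
    using fps_compose_X_mult[OF B0, of "tail_series g'"] by (simp only: Xg)
  then have "fps_X * (g oo B) = A * B"
    by (subst A) (simp only: ac_simps)
  with 2 have "fps_X * (f \<boxtimes> g) = fps_X * (g oo B)" by simp
  then have 3: "f \<boxtimes> g = g oo B" by (rule fps_mult_left_cancel_order_1[rotated 2]) simp_all
  have "A $ 1 = g $ 1" by (subst A) (simp add: tail_series_def g'_def)
  with g have "A $ 1 = 1" by (simp add: G1_def)
  with A0 B0 1 2 3 that show ?thesis by blast
qed

lemma boxed_conv_in_G1:
  fixes f g :: "'a::comm_ring_1 fps"
  assumes "f \<in> G1" "g \<in> G1"
  shows "f \<boxtimes> g \<in> G1"
proof -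
  obtain A B where "A $ 0 = 0" "A $ 1 = 1" "f \<boxtimes> g = f oo A"
    using boxed_conv_functional_equations[OF assms] by metis
  with assms show ?thesis by (simp add: G1_def fps_compose_nth)
qed

section \<open>Logarithmic coordinates\<close>

text \<open>
  The coefficients of \<open>z h'/h\<close> for the compositional inverse \<open>h\<close> of \<open>f\<close>, which is \<open>1\<close> plus the
  logarithmic derivative \<open>z S'/S\<close> of the S-transform. The recursion is the comparison of coefficients in
  \<open>f = z f' (T \<circ> f)\<close>, solved for the highest coefficient of \<open>T\<close>.
\<close>

fun log_coord :: "'a::comm_ring_1 fps \<Rightarrow> nat \<Rightarrow> 'a" where
  "log_coord f n = f $ Suc n - (\<Sum>k<n. log_coord f k * (fps_deriv f * f ^ k) $ n)"

declare log_coord.simps [simp del]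

lemma log_series_relation:
  fixes f :: "'a::comm_ring_1 fps"
  assumes "f \<in> G1"
  shows "f = fps_X * fps_deriv f * (Abs_fps (log_coord f) oo f)"
proof (rule fps_ext)
  fix n
  have f: "f $ 0 = 0" "f $ Suc 0 = 1" using assms by (simp_all add: G1_def)
  show "f $ n = (fps_X * fps_deriv f * (Abs_fps (log_coord f) oo f)) $ n"
  proof (cases n)
    case (Suc m)
    have "(fps_deriv f * f ^ m) $ m = (\<Sum>i=0..m. fps_deriv f $ i * (f ^ m) $ (m - i))"
      by (simp add: fps_mult_nth)
    also have "\<dots> = (\<Sum>i\<in>{0}. fps_deriv f $ i * (f ^ m) $ (m - i))"
      by (rule sum.mono_neutral_right) (use startsby_zero_power_prefix[OF f(1), of m] in auto)
    also have "\<dots> = 1" by (simp add: f startsby_zero_power_nth_same[OF f(1)])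
    finally have diag: "(fps_deriv f * f ^ m) $ m = 1" .
    have "(fps_X * fps_deriv f * (Abs_fps (log_coord f) oo f)) $ n =
        (fps_deriv f * (Abs_fps (log_coord f) oo f)) $ m"
      by (simp add: Suc mult.assoc)
    also have "\<dots> = (\<Sum>k=0..m. log_coord f k * (fps_deriv f * f ^ k) $ m)"
      by (simp add: fps_mult_compose_nth[OF f(1)])
    also have "{0..m} = insert m {..<m}" by auto
    also have "(\<Sum>k\<in>insert m {..<m}. log_coord f k * (fps_deriv f * f ^ k) $ m) = f $ Suc m"
      by (simp add: diag log_coord.simps[of f m])
    finally show ?thesis by (simp add: Suc)
  qed (simp add: f mult.assoc)
qed

lemma log_series_unique:
  fixes f :: "'a::comm_ring_1 fps"
  assumes "f \<in> G1" and U: "f = fps_X * fps_deriv f * (U oo f)"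
  shows "U = Abs_fps (log_coord f)"
proof -
  have f: "f $ 0 = 0" "f $ 1 = 1" using assms(1) by (simp_all add: G1_def)
  have "fps_X * fps_deriv f * (U oo f) = fps_X * fps_deriv f * (Abs_fps (log_coord f) oo f)"
    using U log_series_relation[OF assms(1)] by simp
  then have "U oo f = Abs_fps (log_coord f) oo f"
    by (rule fps_mult_left_cancel_order_1[rotated 2]) (use f in \<open>simp_all add: mult.assoc\<close>)
  then show ?thesis by (rule fps_compose_right_cancel[OF f])
qed

text \<open>
  Let \<open>P = f \<boxtimes> g\<close>, \<open>u = T\<^sub>f \<circ> P\<close> and \<open>v = T\<^sub>g \<circ> P\<close>. Composing \<open>f = z f' (T\<^sub>f \<circ> f)\<close> with \<open>A\<close> and multiplying
  by \<open>A'\<close> gives \<open>P A' = A P' u\<close> by the chain rule, and likewise \<open>P B' = B P' v\<close>. Inserted into \<open>P\<close> times the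
  derivative of \<open>A B = z P\<close>, this becomes \<open>P (P + z P') = z P P' (u + v)\<close>, that is
  \<open>P = z P' ((T\<^sub>f + T\<^sub>g - 1) \<circ> P)\<close>, which characterises \<open>T\<^sub>P\<close>.
\<close>

theorem log_coord_boxed_conv:
  fixes f g :: "'a::comm_ring_1 fps"
  assumes f: "f \<in> G1" and g: "g \<in> G1" and n: "n > 0"
  shows "log_coord (f \<boxtimes> g) n = log_coord f n + log_coord g n"
proof -
  let ?P = "f \<boxtimes> g"
  obtain A B where A: "A $ 0 = 0" "A $ 1 = 1" and B: "B $ 0 = 0"
    and PA: "?P = f oo A" and PB: "?P = g oo B" and AB: "A * B = fps_X * ?P"
    using boxed_conv_functional_equations[OF f g] .
  have P: "?P \<in> G1" by (rule boxed_conv_in_G1[OF f g])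
  have key: "h oo C = C * (fps_deriv h oo C) * (Abs_fps (log_coord h) oo (h oo C))"
    if "h \<in> G1" "C $ 0 = 0" for h C :: "'a fps"
  proof -
    have h0: "h $ 0 = 0" using that(1) by (simp add: G1_def)
    have "h oo C = (fps_X * (fps_deriv h * (Abs_fps (log_coord h) oo h))) oo C"
      using log_series_relation[OF that(1)] by (simp only: mult.assoc)
    also have "\<dots> = C * ((fps_deriv h * (Abs_fps (log_coord h) oo h)) oo C)"
      by (rule fps_compose_X_mult[OF that(2)])
    also have "\<dots> = C * (fps_deriv h oo C) * (Abs_fps (log_coord h) oo (h oo C))"
      by (simp only: fps_compose_mult[OF that(2)] fps_compose_associative[OF that(2) h0] mult.assoc)
    finally show ?thesis .
  qed
  define u where "u = Abs_fps (log_coord f) oo ?P"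
  define v where "v = Abs_fps (log_coord g) oo ?P"
  let ?D = "fps_deriv :: 'a fps \<Rightarrow> 'a fps"
  have dPA: "?D ?P = (?D f oo A) * ?D A" and dPB: "?D ?P = (?D g oo B) * ?D B"
    using fps_compose_chain_rule[OF A(1), of f] fps_compose_chain_rule[OF B, of g]
    by (simp_all only: PA[symmetric] PB[symmetric])
  have uA: "?P = A * (?D f oo A) * u" and vB: "?P = B * (?D g oo B) * v"
    using key[OF f A(1)] key[OF g B] by (simp_all only: PA[symmetric] PB[symmetric] u_def v_def)
  have "?P * ?D A = A * ((?D f oo A) * ?D A) * u"
    by (subst uA) (simp only: ac_simps)
  moreover have "?P * ?D B = B * ((?D g oo B) * ?D B) * v"
    by (subst vB) (simp only: ac_simps)
  ultimately have "?P * ?D A = A * ?D ?P * u" "?P * ?D B = B * ?D ?P * v"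
    by (simp_all only: dPA[symmetric] dPB[symmetric])
  note logs = this
  have "?D A * B + A * ?D B = ?P + fps_X * ?D ?P"
    using arg_cong[OF AB, of ?D] by (simp add: algebra_simps)
  then have "?P * (?P + fps_X * ?D ?P) = ?P * (?D A * B + A * ?D B)"
    by simp
  also have "\<dots> = (?P * ?D A) * B + (?P * ?D B) * A"
    by (simp only: algebra_simps)
  also have "\<dots> = (A * B) * (?D ?P * (u + v))"
    unfolding logs by (simp only: algebra_simps)
  finally have "?P * (?P + fps_X * ?D ?P) = fps_X * ?P * (?D ?P * (u + v))"
    unfolding AB .
  then have "?P * ?P = ?P * (fps_X * ?D ?P * (u + v - 1))"
    by (simp add: algebra_simps)
  then have "?P = fps_X * ?D ?P * (u + v - 1)"
    by (rule fps_mult_left_cancel_order_1[rotated 2]) (use P in \<open>simp_all add: G1_def\<close>)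
  also have "u + v - 1 = (Abs_fps (log_coord f) + Abs_fps (log_coord g) - 1) oo ?P"
    by (simp add: u_def v_def fps_compose_add_distrib fps_compose_sub_distrib)
  finally have "Abs_fps (log_coord f) + Abs_fps (log_coord g) - 1 = Abs_fps (log_coord ?P)"
    by (rule log_series_unique[OF P])
  from arg_cong[OF this, of "\<lambda>h. h $ n"] n show ?thesis by simp
qed

lemma fps_nth_mult_cong:
  assumes "\<And>i. i \<le> n \<Longrightarrow> a $ i = a' $ i" "\<And>i. i \<le> n \<Longrightarrow> b $ i = b' $ i"
  shows "(a * b) $ n = (a' * b') $ n"
  unfolding fps_mult_nth using assms by (intro sum.cong) auto

lemma fps_nth_power_cong:
  assumes "\<And>i. i \<le> n \<Longrightarrow> a $ i = a' $ i"
  shows "(a ^ k) $ n = (a' ^ k) $ n"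
  using assms
proof (induction k arbitrary: n)
  case (Suc k)
  show ?case unfolding power_Suc
    by (rule fps_nth_mult_cong) (use Suc in auto)
qed simp

lemma deriv_power_nth_cong:
  fixes f f' :: "'a::comm_ring_1 fps"
  assumes eq: "\<And>i. i \<le> n \<Longrightarrow> f $ i = f' $ i" and f0: "f $ 0 = 0" and k: "k > 0"
  shows "(fps_deriv f * f ^ k) $ n = (fps_deriv f' * f' ^ k) $ n"
  unfolding fps_mult_nth
proof (rule sum.cong[OF refl])
  fix i assume i: "i \<in> {0..n}"
  have p: "(f ^ k) $ (n - i) = (f' ^ k) $ (n - i)"
    by (rule fps_nth_power_cong) (use eq in auto)
  show "fps_deriv f $ i * (f ^ k) $ (n - i) = fps_deriv f' $ i * (f' ^ k) $ (n - i)"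
  proof (cases "i = n")
    case True
    then have "(f ^ k) $ (n - i) = 0" using startsby_zero_power_prefix[OF f0, of k] k by simp
    then show ?thesis using p by simp
  next
    case False
    then show ?thesis using p i eq[of "Suc i"] by simp
  qed
qed

text \<open>
  The coefficient \<open>f $ Suc n\<close> occurs in the \<open>n\<close>-th coordinate twice: as the leading term of the recursion,
  and, through the derivative, \<open>n + 1\<close> times in the summand \<open>k = 0\<close>. The summands with \<open>0 < k < n\<close>
  do not reach it (\<open>deriv_power_nth_cong\<close>).
\<close>

lemma log_coord_triangular:
  fixes f f' :: "'a::comm_ring_1 fps"
  assumes f: "f \<in> G1" and n: "n > 0" and eq: "\<And>i. i \<le> n \<Longrightarrow> f $ i = f' $ i"
  shows "log_coord f n - log_coord f' n = - of_nat n * (f $ Suc n - f' $ Suc n)"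
proof -
  have f0: "f $ 0 = 0" using f by (simp add: G1_def)
  have lower: "log_coord f m = log_coord f' m" if "m < n" for m
    using that
  proof (induction m rule: less_induct)
    case (less m)
    have "(fps_deriv f * f ^ k) $ m = (fps_deriv f' * f' ^ k) $ m" for k
      by (rule fps_nth_mult_cong) (use less.prems eq in \<open>auto intro: fps_nth_power_cong\<close>)
    then show ?case
      unfolding log_coord.simps[of f m] log_coord.simps[of f' m]
      using less eq[of "Suc m"] by simp
  qed
  have one: "log_coord h 0 = h $ 1" for h :: "'a fps" using log_coord.simps[of h 0] by simp
  have expand: "log_coord h n = h $ Suc n - (\<Sum>k\<in>{0<..<n}. log_coord h k * (fps_deriv h * h ^ k) $ n)
      - h $ 1 * (of_nat (Suc n) * h $ Suc n)" for h :: "'a fps"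
  proof -
    have "{..<n} = insert 0 {0<..<n}" using n by auto
    then show ?thesis by (simp add: log_coord.simps[of h n] one algebra_simps)
  qed
  have middle: "(\<Sum>k\<in>{0<..<n}. log_coord f k * (fps_deriv f * f ^ k) $ n) =
      (\<Sum>k\<in>{0<..<n}. log_coord f' k * (fps_deriv f' * f' ^ k) $ n)"
    using lower deriv_power_nth_cong[OF eq f0] by (intro sum.cong) auto
  have lin: "f $ 1 = 1" "f' $ 1 = 1" using f eq[of 1] n by (simp_all add: G1_def)
  show ?thesis
    unfolding expand[of f] expand[of f'] middle lin by (simp add: algebra_simps)
qed

section \<open>Polynomials among the power series\<close>

abbreviation lookup :: "('v \<Rightarrow>\<^sub>0 nat) \<Rightarrow> 'v \<Rightarrow> nat" where "lookup \<equiv> Poly_Mapping.lookup"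
abbreviation keys :: "('v \<Rightarrow>\<^sub>0 nat) \<Rightarrow> 'v set" where "keys \<equiv> Poly_Mapping.keys"

definition msupp :: "('v, 'a::zero) mfps \<Rightarrow> ('v \<Rightarrow>\<^sub>0 nat) set" where
  "msupp f = {m. mcoeff f m \<noteq> 0}"

definition mconst :: "'a::zero \<Rightarrow> ('v, 'a) mfps" where
  "mconst c = Abs_mfps (\<lambda>m. if m = 0 then c else 0)"

definition meval :: "('v \<Rightarrow> 'r::comm_monoid_mult) \<Rightarrow> ('v \<Rightarrow>\<^sub>0 nat) \<Rightarrow> 'r" where
  "meval g k = (\<Prod>v\<in>keys k. g v ^ lookup k v)"

lemma meval_superset: "finite K \<Longrightarrow> keys k \<subseteq> K \<Longrightarrow> meval g k = (\<Prod>v\<in>K. g v ^ lookup k v)"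
  unfolding meval_def by (rule prod.mono_neutral_left) (auto simp: in_keys_iff)

lemma meval_add: "meval g (a + b) = meval g a * meval g b"
proof -
  have "finite (keys a \<union> keys b)" "keys (a + b) \<subseteq> keys a \<union> keys b"
    by (auto simp: Poly_Mapping.keys_add)
  then show ?thesis
    using meval_superset[of "keys a \<union> keys b" a g] meval_superset[of "keys a \<union> keys b" b g]
      meval_superset[of "keys a \<union> keys b" "a + b" g]
    by (simp add: lookup_add power_add prod.distrib)
qed

lemma meval_0 [simp]: "meval g 0 = 1"
  by (simp add: meval_def)

lemma meval_single [simp]: "meval g (Poly_Mapping.single v 1) = g v"
  by (simp add: meval_def)

lemma mcoeff_msubst:
  assumes "finite K" "msupp f \<subseteq> K"
  shows "mcoeff (msubst f g) m = (\<Sum>k\<in>K. mcoeff f k * mcoeff (meval g k) m)"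
  unfolding msubst_def mcoeff_Abs meval_def
  by (rule Sum_any.expand_superset[OF assms(1)]) (use assms(2) in \<open>auto simp: msupp_def\<close>)

lemma mcoeff_sum: "mcoeff (\<Sum>i\<in>I. f i) m = (\<Sum>i\<in>I. mcoeff (f i) m)"
  by (induction I rule: infinite_finite_induct) simp_all

lemma mcoeff_mconst_mult:
  fixes f :: "('v, 'a::comm_ring) mfps"
  shows "mcoeff (mconst c * f) m = c * mcoeff f m"
proof -
  have "mcoeff (mconst c * f) m = (\<Sum>(a, b)\<in>{(0, m)}. mcoeff (mconst c :: ('v, 'a) mfps) a * mcoeff f b)"
    unfolding mcoeff_mult
    by (rule sum.mono_neutral_right) (auto simp: mconst_def finite_monomial_splits split: if_splits)
  then show ?thesis by (simp add: mconst_def)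
qed

lemma msubst_eq_sum:
  fixes f :: "('v, 'a::{comm_ring, comm_monoid_mult}) mfps" and g :: "'v \<Rightarrow> ('w, 'a) mfps"
  assumes "finite K" "msupp f \<subseteq> K"
  shows "msubst f g = (\<Sum>k\<in>K. mconst (mcoeff f k) * meval g k)"
  by (rule mfps_eqI) (simp add: mcoeff_msubst[OF assms] mcoeff_sum mcoeff_mconst_mult)

lemma mconst_add: "mconst (a + b) = mconst a + mconst (b :: 'a::comm_ring)"
  by (rule mfps_eqI) (simp add: mconst_def)

lemma mconst_mult: "mconst (a * b) = mconst a * mconst (b :: 'a::comm_ring)"
  by (rule mfps_eqI) (subst mcoeff_mconst_mult, simp add: mconst_def)

lemma mconst_sum: "mconst (\<Sum>i\<in>I. f i :: 'a::comm_ring) = (\<Sum>i\<in>I. mconst (f i))"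
  by (rule mfps_eqI) (auto simp: mcoeff_sum mconst_def)

lemma mconst_1: "mconst 1 = (1 :: ('v, 'a::comm_ring_1) mfps)"
  by (rule mfps_eqI) (simp add: mconst_def mcoeff_one)

lemma mconst_of_nat: "mconst (of_nat n) = (of_nat n :: ('v, 'a::comm_ring_1) mfps)"
proof (induction n)
  case 0
  show ?case by (rule mfps_eqI) (simp add: mconst_def)
qed (simp add: mconst_add mconst_1)

definition polys :: "'v set \<Rightarrow> ('v, 'a::zero) mfps set" where
  "polys V = {f. finite (msupp f) \<and> mvars f \<subseteq> V}"

lemma polysI: "finite M \<Longrightarrow> msupp f \<subseteq> M \<Longrightarrow> (\<And>m. m \<in> M \<Longrightarrow> keys m \<subseteq> V) \<Longrightarrow> f \<in> polys V"
  unfolding polys_def mvars_def msupp_def using finite_subset by fastforce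

lemma polysD: "f \<in> polys V \<Longrightarrow> finite (msupp f)" "f \<in> polys V \<Longrightarrow> m \<in> msupp f \<Longrightarrow> keys m \<subseteq> V"
  by (auto simp: polys_def mvars_def msupp_def)

lemma msupp_mult: "msupp (f * g) \<subseteq> (\<lambda>(a, b). a + b) ` (msupp f \<times> msupp g)"
proof
  fix m assume "m \<in> msupp (f * g)"
  then have "(\<Sum>(a, b) | a + b = m. mcoeff f a * mcoeff g b) \<noteq> 0"
    by (simp add: msupp_def mcoeff_mult)
  then obtain p where p: "p \<in> {(a, b). a + b = m}" "(case p of (a, b) \<Rightarrow> mcoeff f a * mcoeff g b) \<noteq> 0"
    by (rule sum.not_neutral_contains_not_neutral)
  then obtain a b where ab: "p = (a, b)" "m = a + b" "mcoeff f a * mcoeff g b \<noteq> 0" by auto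
  then have "(a, b) \<in> msupp f \<times> msupp g" using mult_not_zero[OF ab(3)] by (simp add: msupp_def)
  then show "m \<in> (\<lambda>(a, b). a + b) ` (msupp f \<times> msupp g)" by (rule rev_image_eqI) (simp add: ab(2))
qed

lemma polys_mconst: "mconst c \<in> polys V"
  by (rule polysI[of "{0}"]) (auto simp: msupp_def mconst_def split: if_splits)

lemma polys_0: "0 \<in> polys V"
  by (rule polysI[of "{}"]) (auto simp: msupp_def)

lemma polys_1: "(1 :: ('v, 'a::comm_ring_1) mfps) \<in> polys V"
  using polys_mconst[of "1 :: 'a" V] by (simp only: mconst_1)

lemma polys_mvar: "v \<in> V \<Longrightarrow> (mvar v :: ('v, 'a::{zero,one}) mfps) \<in> polys V"
  by (rule polysI[of "{Poly_Mapping.single v 1}"]) (auto simp: msupp_def mvar_def split: if_splits)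

lemma polys_add: 
  fixes f g :: "('v, 'a::comm_ring) mfps"
  shows "f \<in> polys V \<Longrightarrow> g \<in> polys V \<Longrightarrow> f + g \<in> polys V"
  by (rule polysI[of "msupp f \<union> msupp g"]) (auto simp: polysD msupp_def dest: polysD[unfolded msupp_def])

lemma polys_diff:
  fixes f g :: "('v, 'a::comm_ring) mfps"
  shows "f \<in> polys V \<Longrightarrow> g \<in> polys V \<Longrightarrow> f - g \<in> polys V"
  by (rule polysI[of "msupp f \<union> msupp g"]) (auto simp: polysD msupp_def dest: polysD[unfolded msupp_def])

lemma polys_mult:
  fixes f g :: "('v, 'a::comm_ring) mfps"
  assumes f: "f \<in> polys V" and g: "g \<in> polys V"
  shows "f * g \<in> polys V"
proof (rule polysI[OF _ msupp_mult])
  show "finite ((\<lambda>(a, b). a + b) ` (msupp f \<times> msupp g))" using polysD(1)[OF f] polysD(1)[OF g] by simp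
  fix m assume "m \<in> (\<lambda>(a, b). a + b) ` (msupp f \<times> msupp g)"
  then obtain a b where "m = a + b" "a \<in> msupp f" "b \<in> msupp g" by auto
  then show "keys m \<subseteq> V"
    using polysD(2)[OF f, of a] polysD(2)[OF g, of b] Poly_Mapping.keys_add[of a b] by blast
qed

lemma msubst_add:
  fixes f h :: "('v, 'a::{comm_ring, comm_monoid_mult}) mfps"
  assumes "f \<in> polys V" "h \<in> polys V"
  shows "msubst (f + h) g = msubst f g + msubst h g"
proof -
  let ?K = "msupp f \<union> msupp h"
  have "finite ?K" "msupp f \<subseteq> ?K" "msupp h \<subseteq> ?K" "msupp (f + h) \<subseteq> ?K"
    using assms by (auto simp: polysD) (auto simp: msupp_def)
  then show ?thesis
    by (simp add: msubst_eq_sum[of ?K] mconst_add distrib_right sum.distrib)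
qed

lemma msubst_mconst:
  fixes c :: "'a::comm_ring_1"
  shows "msubst (mconst c) g = mconst c"
  by (subst msubst_eq_sum[of "{0}"]) (auto simp: msupp_def mconst_def split: if_splits)

lemma msubst_mvar:
  fixes g :: "'v \<Rightarrow> ('w, 'a::comm_ring_1) mfps"
  shows "msubst (mvar v) g = g v"
  by (subst msubst_eq_sum[of "{Poly_Mapping.single v 1}"])
    (auto simp: msupp_def mvar_def mconst_1 simp del: One_nat_def split: if_splits)

text \<open>
  Collect the products of monomials of \<open>f\<close> and \<open>h\<close> by their product monomial. The support of \<open>f * h\<close> may be
  smaller than the set of these products because of cancellation, so the sum is taken over the latter.
\<close>

lemma msubst_mult:
  fixes f h :: "('v, 'a::{comm_ring, comm_monoid_mult}) mfps"
  assumes "f \<in> polys V" "h \<in> polys V"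
  shows "msubst (f * h) g = msubst f g * msubst h g"
proof -
  let ?F = "msupp f" and ?H = "msupp h" and ?p = "\<lambda>(a, b). a + b :: 'v \<Rightarrow>\<^sub>0 nat"
  let ?K = "?p ` (?F \<times> ?H)"
  have fin: "finite ?F" "finite ?H" using assms by (auto simp: polysD)
  have "mcoeff (f * h) k = (\<Sum>(a, b)\<in>{x \<in> ?F \<times> ?H. ?p x = k}. mcoeff f a * mcoeff h b)" for k
    unfolding mcoeff_mult
    by (rule sum.mono_neutral_right) (auto simp: finite_monomial_splits msupp_def)
  then have "mconst (mcoeff (f * h) k) * meval g k = (\<Sum>(a, b)\<in>{x \<in> ?F \<times> ?H. ?p x = k}.
      mconst (mcoeff f a) * meval g a * (mconst (mcoeff h b) * meval g b))" for k
    by (simp only: mconst_sum sum_distrib_right)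
      (auto simp: mconst_mult meval_add ac_simps intro!: sum.cong)
  then have "msubst (f * h) g = (\<Sum>k\<in>?K. \<Sum>(a, b)\<in>{x \<in> ?F \<times> ?H. ?p x = k}.
      mconst (mcoeff f a) * meval g a * (mconst (mcoeff h b) * meval g b))"
    using fin msupp_mult[of f h] by (simp add: msubst_eq_sum[of ?K])
  also have "\<dots> = (\<Sum>(a, b)\<in>?F \<times> ?H. mconst (mcoeff f a) * meval g a * (mconst (mcoeff h b) * meval g b))"
    by (rule sum.image_gen[symmetric]) (use fin in simp)
  also have "\<dots> = msubst f g * msubst h g"
    using fin by (simp add: msubst_eq_sum[of ?F f] msubst_eq_sum[of ?H h] sum_product sum.cartesian_product)
  finally show ?thesis .
qed

section \<open>Naturality of the logarithmic coordinates\<close>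

text \<open>
  Substituting arbitrary series is multiplicative on polynomials but need not be so on all series, whence
  homomorphisms are considered on a subring \<open>S\<close>.
\<close>

locale partial_ring_hom =
  fixes S :: "'r::comm_ring_1 set" and \<phi> :: "'r \<Rightarrow> 's::comm_ring_1"
  assumes zero: "0 \<in> S" and one: "1 \<in> S"
    and add: "x \<in> S \<Longrightarrow> y \<in> S \<Longrightarrow> x + y \<in> S" and diff: "x \<in> S \<Longrightarrow> y \<in> S \<Longrightarrow> x - y \<in> S"
    and mult: "x \<in> S \<Longrightarrow> y \<in> S \<Longrightarrow> x * y \<in> S"
    and hom_one: "\<phi> 1 = 1" and hom_add: "x \<in> S \<Longrightarrow> y \<in> S \<Longrightarrow> \<phi> (x + y) = \<phi> x + \<phi> y"
    and hom_mult: "x \<in> S \<Longrightarrow> y \<in> S \<Longrightarrow> \<phi> (x * y) = \<phi> x * \<phi> y"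
begin

lemma hom_zero: "\<phi> 0 = 0"
  using hom_add[OF zero zero] by simp

lemma hom_diff: "x \<in> S \<Longrightarrow> y \<in> S \<Longrightarrow> \<phi> (x - y) = \<phi> x - \<phi> y"
  using hom_add[OF diff, of x y y] by simp

lemma hom_sum: "(\<And>i. i \<in> I \<Longrightarrow> h i \<in> S) \<Longrightarrow> (\<Sum>i\<in>I. h i) \<in> S \<and> \<phi> (\<Sum>i\<in>I. h i) = (\<Sum>i\<in>I. \<phi> (h i))"
  by (induction I rule: infinite_finite_induct) (simp_all add: zero hom_zero add hom_add)

lemma hom_of_nat: "of_nat n \<in> S \<and> \<phi> (of_nat n) = of_nat n"
  by (induction n) (simp_all add: zero one add hom_zero hom_one hom_add)

definition fps_over :: "'r fps \<Rightarrow> bool" where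
  "fps_over f \<longleftrightarrow> (\<forall>n. f $ n \<in> S)"

definition map_fps :: "'r fps \<Rightarrow> 's fps" where
  "map_fps f = Abs_fps (\<lambda>n. \<phi> (f $ n))"

lemma map_mult:
  assumes "fps_over f" "fps_over g"
  shows "fps_over (f * g)" "map_fps (f * g) = map_fps f * map_fps g"
proof -
  have "f $ i * g $ j \<in> S" "\<phi> (f $ i * g $ j) = \<phi> (f $ i) * \<phi> (g $ j)" for i j
    using assms by (simp_all add: fps_over_def mult hom_mult)
  then have "(f * g) $ n \<in> S \<and> \<phi> ((f * g) $ n) = (map_fps f * map_fps g) $ n" for n
    using hom_sum[of "{0..n}" "\<lambda>i. f $ i * g $ (n - i)"] by (simp add: fps_mult_nth map_fps_def)
  then show "fps_over (f * g)" "map_fps (f * g) = map_fps f * map_fps g"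
    by (simp_all add: fps_over_def fps_eq_iff) (simp add: map_fps_def)
qed

lemma map_power:
  assumes "fps_over f"
  shows "fps_over (f ^ k) \<and> map_fps (f ^ k) = map_fps f ^ k"
proof (induction k)
  case 0
  show ?case by (auto simp: fps_over_def map_fps_def fps_eq_iff zero one hom_zero hom_one)
next
  case (Suc k)
  then show ?case using map_mult[OF assms, of "f ^ k"] by simp
qed

lemma map_deriv:
  assumes "fps_over f"
  shows "fps_over (fps_deriv f)" "map_fps (fps_deriv f) = fps_deriv (map_fps f)"
proof -
  have *: "fps_deriv f $ n \<in> S \<and> \<phi> (fps_deriv f $ n) = fps_deriv (map_fps f) $ n" for n
  proof -
    have "of_nat (Suc n) \<in> S" "\<phi> (of_nat (Suc n)) = of_nat (Suc n)" "f $ Suc n \<in> S"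
      using hom_of_nat[of "Suc n"] assms by (simp_all only: fps_over_def)
    then show ?thesis unfolding fps_deriv_nth Suc_eq_plus1[symmetric]
      by (simp only: mult hom_mult map_fps_def fps_nth_Abs_fps)
  qed
  show "fps_over (fps_deriv f)" unfolding fps_over_def using * by blast
  show "map_fps (fps_deriv f) = fps_deriv (map_fps f)"
    by (rule fps_ext) (use * in \<open>simp only: map_fps_def fps_nth_Abs_fps\<close>)
qed

text \<open>
  The recursion for \<open>log_coord\<close> uses nothing but ring operations.
\<close>

lemma log_coord_natural:
  assumes f: "fps_over f"
  shows "log_coord f n \<in> S \<and> \<phi> (log_coord f n) = log_coord (map_fps f) n"
proof (induction n rule: less_induct)
  case (less n)
  let ?h = "\<lambda>k. log_coord f k * (fps_deriv f * f ^ k) $ n"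
  have h: "?h k \<in> S \<and> \<phi> (?h k) = log_coord (map_fps f) k * (fps_deriv (map_fps f) * map_fps f ^ k) $ n"
    if "k < n" for k
  proof -
    have p: "fps_over (f ^ k)" "map_fps (f ^ k) = map_fps f ^ k" using map_power[OF f] by auto
    note d = map_deriv[OF f]
    note m = map_mult[OF d(1) p(1)]
    have "(fps_deriv f * f ^ k) $ n \<in> S" using m(1) by (simp add: fps_over_def)
    moreover have "\<phi> ((fps_deriv f * f ^ k) $ n) = map_fps (fps_deriv f * f ^ k) $ n" by (simp add: map_fps_def)
    ultimately show ?thesis
      using less[OF that] unfolding m(2) d(2) p(2) by (simp add: mult hom_mult)
  qed
  have s: "(\<Sum>k<n. ?h k) \<in> S" "\<phi> (\<Sum>k<n. ?h k) = (\<Sum>k<n. \<phi> (?h k))"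
    using hom_sum[of "{..<n}" ?h] h by auto
  have "f $ Suc n \<in> S" using f by (simp add: fps_over_def)
  then show ?case
    unfolding log_coord.simps[of f n] log_coord.simps[of "map_fps f" n]
    using s h by (simp add: diff hom_diff) (simp add: map_fps_def)
qed

lemma log_coord_G1_elem:
  assumes c: "\<And>i. i \<ge> 2 \<Longrightarrow> c i \<in> S" and c': "\<And>i. i \<ge> 2 \<Longrightarrow> \<phi> (c i) = c' i"
  shows "log_coord (G1_elem c) n \<in> S" "\<phi> (log_coord (G1_elem c) n) = log_coord (G1_elem c') n"
proof -
  have "fps_over (G1_elem c)"
    by (auto simp: fps_over_def G1_elem_def zero one c)
  moreover have "map_fps (G1_elem c) = G1_elem c'"
    by (rule fps_ext) (auto simp: map_fps_def G1_elem_def hom_zero hom_one c')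
  ultimately show "log_coord (G1_elem c) n \<in> S" "\<phi> (log_coord (G1_elem c) n) = log_coord (G1_elem c') n"
    using log_coord_natural[of "G1_elem c" n] by auto
qed

end

lemma partial_ring_hom_msubst: "partial_ring_hom (polys V) (\<lambda>f :: ('v, 'a::comm_ring_1) mfps. msubst f g)"
proof
  show "msubst 1 g = 1" using msubst_mconst[of 1 g] by (simp only: mconst_1)
qed (fact polys_0 polys_1 polys_add polys_diff polys_mult msubst_add msubst_mult)+

lemma partial_ring_hom_mcoeff_0: "partial_ring_hom UNIV (\<lambda>f :: ('v, 'a::comm_ring_1) mfps. mcoeff f 0)"
proof
  fix f g :: "('v, 'a) mfps"
  have "{(a, b). a + b = (0 :: 'v \<Rightarrow>\<^sub>0 nat)} = {(0, 0)}"
  proof -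
    have "a = 0" if "a + b = 0" for a b :: "'v \<Rightarrow>\<^sub>0 nat"
      by (rule poly_mapping_eqI) (use arg_cong[OF that, of "\<lambda>m. lookup m _"] in \<open>simp add: lookup_add\<close>)
    then show ?thesis by (auto simp: add.commute) (metis add.commute)+
  qed
  then show "mcoeff (f * g) 0 = mcoeff f 0 * mcoeff g 0" by (simp add: mcoeff_mult)
qed (simp_all add: mcoeff_one)

section \<open>The isomorphism over the rationals\<close>

text \<open>
  The logarithmic coordinates of the generic element of \<open>G1\<close>. The shift of the index comes from
  the factor \<open>z\<close> between \<open>f\<close> and the S-transform.
\<close>

definition log_family :: "nat \<Rightarrow> (nat, rat) mfps" where
  "log_family n = log_coord (G1_elem mvar) (n - 1)"

text \<open>
  Solving \<open>log_coord (G1_elem \<eta>) (n - 1) = x\<^sub>n\<close> for \<open>\<eta>\<^sub>n\<close>, on which the left-hand side depends through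
  \<open>- (n - 1) \<eta>\<^sub>n\<close> only, when \<open>\<eta>\<^sub>i\<close> is known for \<open>i < n\<close>.
\<close>

fun exp_family :: "nat \<Rightarrow> (nat, rat) mfps" where
  "exp_family n = mconst (1 / of_nat (n - 1)) *
     (log_coord (G1_elem (\<lambda>i. if i < n then exp_family i else 0)) (n - 1) - mvar n)"

declare exp_family.simps [simp del]

lemma G1_elem_in_G1: "G1_elem c \<in> G1"
  by (simp add: G1_elem_def G1_def)

lemma G1_elem_nth: "n \<ge> 2 \<Longrightarrow> G1_elem c $ n = c n"
  by (simp add: G1_elem_def)

text \<open>
  Triangularity for truncated families; both compositions of \<open>log_family\<close> and \<open>exp_family\<close> rest on it.
\<close>

lemma log_coord_split_last:
  fixes c :: "nat \<Rightarrow> ('v, rat) mfps"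
  assumes n: "n \<ge> 2"
  shows "mconst (1 / of_nat (n - 1)) * (log_coord (G1_elem (\<lambda>i. if i < n then c i else 0)) (n - 1) -
      log_coord (G1_elem c) (n - 1)) = c n"
proof -
  let ?d = "\<lambda>i. if i < n then c i else 0"
  have "log_coord (G1_elem c) (n - 1) - log_coord (G1_elem ?d) (n - 1) =
      - of_nat (n - 1) * (G1_elem c $ Suc (n - 1) - G1_elem ?d $ Suc (n - 1))"
    by (rule log_coord_triangular[OF G1_elem_in_G1]) (use n in \<open>auto simp: G1_elem_def\<close>)
  also have "G1_elem c $ Suc (n - 1) - G1_elem ?d $ Suc (n - 1) = c n"
    using n by (simp add: G1_elem_nth)
  finally have "log_coord (G1_elem ?d) (n - 1) - log_coord (G1_elem c) (n - 1) = of_nat (n - 1) * c n"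
    by (simp add: algebra_simps)
  moreover have "mconst (1 / of_nat (n - 1)) * (of_nat (n - 1) :: ('v, rat) mfps) = 1"
    using n unfolding mconst_of_nat[symmetric] mconst_mult[symmetric] by (simp add: mconst_1)
  ultimately show ?thesis by (metis mult.assoc mult_1)
qed

lemma log_family_polys: "log_family n \<in> polys {2..}"
  unfolding log_family_def
  by (rule partial_ring_hom.log_coord_G1_elem(1)[OF partial_ring_hom_msubst[of _ mvar], of _ _ mvar])
    (auto intro: polys_mvar simp: msubst_mvar)

lemma exp_family_polys: "n \<ge> 2 \<Longrightarrow> exp_family n \<in> polys {2..}"
proof (induction n rule: less_induct)
  case (less n)
  have "log_coord (G1_elem (\<lambda>i. if i < n then exp_family i else 0)) (n - 1) \<in> polys {2..}"
    by (rule partial_ring_hom.log_coord_G1_elem(1)[OF partial_ring_hom_msubst[of _ mvar], OF _ refl])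
      (use less in \<open>auto intro: polys_0\<close>)
  then show ?case
    using less.prems by (subst exp_family.simps) (auto intro!: polys_mult polys_mconst polys_diff polys_mvar)
qed

text \<open>
  The unit of the boxed convolution has vanishing coordinates; hence \<open>log_family\<close> and \<open>exp_family\<close>
  have no constant terms.
\<close>

lemma log_coord_G1_elem_0: "n > 0 \<Longrightarrow> log_coord (G1_elem (\<lambda>_. 0) :: 'a::comm_ring_1 fps) n = 0"
proof -
  have X: "G1_elem (\<lambda>_. 0) = (fps_X :: 'a fps)"
    by (rule fps_ext) (simp add: G1_elem_def fps_X_def)
  have "(1 :: 'a fps) = Abs_fps (log_coord (fps_X :: 'a fps))"
    by (rule log_series_unique) (simp_all add: G1_def)
  from arg_cong[OF this, of "\<lambda>h. h $ n"] show "n > 0 \<Longrightarrow> ?thesis" by (simp add: X)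
qed

lemma mvar_nth_0: "mcoeff (mvar v :: ('v, 'a::zero_neq_one) mfps) 0 = 0"
proof -
  have "lookup (Poly_Mapping.single v 1) v \<noteq> lookup 0 v" by simp
  then have "0 \<noteq> Poly_Mapping.single v (1 :: nat)" by metis
  then show ?thesis by (simp add: mvar_def)
qed

lemma log_family_nth_0: "n \<ge> 2 \<Longrightarrow> mcoeff (log_family n) 0 = 0"
  unfolding log_family_def
  by (subst partial_ring_hom.log_coord_G1_elem(2)[OF partial_ring_hom_mcoeff_0, of _ "\<lambda>_. 0"])
    (simp_all add: mvar_nth_0 log_coord_G1_elem_0)

lemma exp_family_nth_0: "n \<ge> 2 \<Longrightarrow> mcoeff (exp_family n) 0 = 0"
proof (induction n rule: less_induct)
  case (less n)
  have "mcoeff (log_coord (G1_elem (\<lambda>i. if i < n then exp_family i else 0)) (n - 1)) 0 =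
      log_coord (G1_elem (\<lambda>_. 0)) (n - 1)"
    by (rule partial_ring_hom.log_coord_G1_elem(2)[OF partial_ring_hom_mcoeff_0]) (use less in auto)
  then show ?case
    using less.prems
    by (subst exp_family.simps) (simp add: mcoeff_mconst_mult mvar_nth_0 log_coord_G1_elem_0)
qed

text \<open>
  By naturality, evaluating the generic logarithmic coordinates means taking those of the evaluated
  series.
\<close>

lemma msubst_log_family: "msubst (log_family n) g = log_coord (G1_elem g) (n - 1)"
  unfolding log_family_def
  by (rule partial_ring_hom.log_coord_G1_elem(2)[OF partial_ring_hom_msubst[of "{2..}" g]])
    (auto intro: polys_mvar simp: msubst_mvar)

lemma log_family_exp_family:
  assumes n: "n \<ge> 2"
  shows "msubst (log_family n) exp_family = mvar n"
proof -
  let ?L = "log_coord (G1_elem (\<lambda>i. if i < n then exp_family i else 0)) (n - 1)"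
  let ?m = "mconst (1 / of_nat (n - 1)) :: (nat, rat) mfps"
  have "?m * (?L - log_coord (G1_elem exp_family) (n - 1)) = ?m * (?L - mvar n)"
    using log_coord_split_last[OF n, of exp_family] exp_family.simps[of n] by simp
  then have "of_nat (n - 1) * (?m * (?L - log_coord (G1_elem exp_family) (n - 1))) =
      of_nat (n - 1) * (?m * (?L - mvar n))" by simp
  moreover have "of_nat (n - 1) * ?m = 1"
    using n unfolding mconst_of_nat[symmetric] mconst_mult[symmetric] by (simp add: mconst_1)
  ultimately have "?L - log_coord (G1_elem exp_family) (n - 1) = ?L - mvar n"
    by (simp only: mult.assoc[symmetric] mult_1)
  then show ?thesis by (simp add: msubst_log_family)
qed

lemma exp_family_log_family: "n \<ge> 2 \<Longrightarrow> msubst (exp_family n) log_family = mvar n"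
proof (induction n rule: less_induct)
  case (less n)
  interpret h: partial_ring_hom "polys {2..}" "\<lambda>f. msubst f log_family"
    by (rule partial_ring_hom_msubst)
  let ?e = "\<lambda>i. if i < n then exp_family i else 0"
  let ?L = "log_coord (G1_elem ?e) (n - 1)"
  have e: "?e i \<in> polys {2..}" if "i \<ge> 2" for i using exp_family_polys[OF that] polys_0 by auto
  have L: "?L \<in> polys {2..}" by (rule h.log_coord_G1_elem(1)[OF e refl])
  have "msubst ?L log_family = log_coord (G1_elem (\<lambda>i. if i < n then mvar i else 0)) (n - 1)"
    by (rule h.log_coord_G1_elem(2)[OF e]) (use less.IH h.hom_zero in auto)
  then have "msubst (?L - mvar n) log_family =
      log_coord (G1_elem (\<lambda>i. if i < n then mvar i else 0)) (n - 1) - log_family n"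
    using h.hom_diff[OF L polys_mvar[of n]] less.prems by (simp add: msubst_mvar)
  moreover have "msubst (exp_family n) log_family =
      mconst (1 / of_nat (n - 1)) * msubst (?L - mvar n) log_family"
    unfolding exp_family.simps[of n]
    using h.hom_mult[OF polys_mconst polys_diff[OF L polys_mvar[of n]]] less.prems
    by (simp add: msubst_mconst)
  ultimately show ?case
    using log_coord_split_last[OF less.prems, of mvar] by (simp add: log_family_def[of n])
qed

lemma log_family_additive:
  assumes n: "n \<ge> 2"
  shows "msubst (log_family n) boxed_law = in_x (log_family n) + in_y (log_family n)"
proof -
  let ?x = "G1_elem (\<lambda>i. mvar (Inl i)) :: (nat + nat, rat) mfps fps"
  let ?y = "G1_elem (\<lambda>i. mvar (Inr i)) :: (nat + nat, rat) mfps fps"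
  have "G1_elem boxed_law = ?x \<boxtimes> ?y"
    using boxed_conv_in_G1[OF G1_elem_in_G1 G1_elem_in_G1, of "\<lambda>i. mvar (Inl i)" "\<lambda>i. mvar (Inr i)"]
    by (intro fps_ext) (auto simp: G1_elem_def boxed_law_def G1_def)
  then have "msubst (log_family n) boxed_law = log_coord (?x \<boxtimes> ?y) (n - 1)"
    by (simp add: msubst_log_family)
  also have "\<dots> = log_coord ?x (n - 1) + log_coord ?y (n - 1)"
    by (rule log_coord_boxed_conv[OF G1_elem_in_G1 G1_elem_in_G1]) (use n in simp)
  finally show ?thesis by (simp add: in_x_def in_y_def msubst_log_family)
qed

section \<open>Base change\<close>

locale coefficient_hom =
  fixes \<phi> :: "'a::{comm_ring, comm_monoid_mult} \<Rightarrow> 'b::{comm_ring, comm_monoid_mult}"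
  assumes hom_add: "\<phi> (x + y) = \<phi> x + \<phi> y" and hom_mult: "\<phi> (x * y) = \<phi> x * \<phi> y" and hom_1: "\<phi> 1 = 1"
begin

definition base_change :: "('v, 'a) mfps \<Rightarrow> ('v, 'b) mfps" where
  "base_change f = Abs_mfps (\<lambda>m. \<phi> (mcoeff f m))"

lemma mcoeff_base_change: "mcoeff (base_change f) m = \<phi> (mcoeff f m)"
  by (simp add: base_change_def)

lemma hom_0: "\<phi> 0 = 0"
  using hom_add[of 0 0] by simp

lemma hom_sum: "\<phi> (\<Sum>i\<in>I. h i) = (\<Sum>i\<in>I. \<phi> (h i))"
  by (induction I rule: infinite_finite_induct) (simp_all add: hom_0 hom_add)

lemma base_change_0: "base_change 0 = 0"
  by (rule mfps_eqI) (simp add: mcoeff_base_change hom_0)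

lemma base_change_1: "base_change 1 = 1"
  by (rule mfps_eqI) (simp add: mcoeff_base_change mcoeff_one hom_0 hom_1)

lemma base_change_mvar: "base_change (mvar v) = mvar v"
  by (rule mfps_eqI) (simp add: mcoeff_base_change mvar_def hom_0 hom_1)

lemma base_change_add: "base_change (f + g) = base_change f + base_change g"
  by (rule mfps_eqI) (simp add: mcoeff_base_change hom_add)

lemma base_change_mult: "base_change (f * g) = base_change f * base_change g"
  by (rule mfps_eqI) (simp add: mcoeff_base_change mcoeff_mult hom_sum hom_mult case_prod_unfold)

lemma base_change_sum: "base_change (\<Sum>i\<in>I. h i) = (\<Sum>i\<in>I. base_change (h i))"
  by (induction I rule: infinite_finite_induct) (simp_all add: base_change_0 base_change_add)

lemma base_change_prod: "base_change (\<Prod>i\<in>I. h i) = (\<Prod>i\<in>I. base_change (h i))"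
  by (induction I rule: infinite_finite_induct) (simp_all add: base_change_1 base_change_mult)

lemma base_change_power: "base_change (f ^ n) = base_change f ^ n"
  by (induction n) (simp_all add: base_change_1 base_change_mult)

text \<open>
  For polynomials the substitution is a finite sum, indexed by the monomials of the source
  even where their coefficients are mapped to zero.
\<close>

lemma base_change_msubst:
  assumes "finite (msupp f)"
  shows "base_change (msubst f g) = msubst (base_change f) (\<lambda>v. base_change (g v))"
proof (rule mfps_eqI)
  fix m
  have "msupp (base_change f) \<subseteq> msupp f"
    by (auto simp: msupp_def mcoeff_base_change hom_0)
  moreover have "base_change (meval g k) = meval (\<lambda>v. base_change (g v)) k" for k
    by (simp add: meval_def base_change_prod base_change_power)
  then have "\<phi> (mcoeff (meval g k) m) = mcoeff (meval (\<lambda>v. base_change (g v)) k) m" for k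
    by (metis mcoeff_base_change)
  ultimately show "mcoeff (base_change (msubst f g)) m = mcoeff (msubst (base_change f) (\<lambda>v. base_change (g v))) m"
    by (simp add: mcoeff_base_change mcoeff_msubst[OF assms] hom_sum hom_mult)
qed

lemma base_change_boxed_law: "base_change (boxed_law n) = boxed_law n"
proof -
  have G: "base_change (G1_elem (\<lambda>i. mvar (h i)) $ k) = G1_elem (\<lambda>i. mvar (h i)) $ k" for h :: "nat \<Rightarrow> nat + nat" and k
    by (simp add: G1_elem_def base_change_0 base_change_1 base_change_mvar)
  then show ?thesis
    by (simp add: boxed_law_def boxed_conv_def X_part_def base_change_0 base_change_sum base_change_mult
        base_change_prod)
qed

lemma base_change_additive_law: "base_change (additive_law i) = additive_law i"
  by (simp add: additive_law_def base_change_add base_change_mvar)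

lemma admissible_base_change:
  assumes "\<And>i. i \<in> I \<Longrightarrow> \<theta> i \<in> polys I" "\<And>i. i \<in> I \<Longrightarrow> mcoeff (\<theta> i) 0 = 0"
  shows "admissible I (\<lambda>i. base_change (\<theta> i))"
  unfolding admissible_def
proof (intro ballI conjI)
  fix i assume i: "i \<in> I"
  show "mcoeff (base_change (\<theta> i)) 0 = 0" using assms(2)[OF i] by (simp add: mcoeff_base_change hom_0)
  have sub: "mvars (base_change (\<theta> i)) \<subseteq> mvars (\<theta> i)"
    by (auto simp: mvars_def mcoeff_base_change) (metis hom_0)
  have "mvars (\<theta> i) = (\<Union>m\<in>msupp (\<theta> i). keys m)" by (auto simp: mvars_def msupp_def)
  then have "finite (mvars (\<theta> i))" using assms(1)[OF i] by (simp add: polysD(1))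
  then show "finite (mvars (base_change (\<theta> i)))" using sub finite_subset by blast
  show "mvars (base_change (\<theta> i)) \<subseteq> I" using sub assms(1)[OF i] by (auto simp: polys_def)
qed

end

theorem theorem13p1:
  fixes scale :: "rat \<Rightarrow> 'a \<Rightarrow> 'a::{comm_ring, comm_monoid_mult}"
  assumes "comm_rat_algebra scale"
  shows "formal_groups_isomorphic {2..}
           (boxed_law :: nat \<Rightarrow> (nat + nat, 'a) mfps) additive_law"
proof -
  interpret comm_rat_algebra scale by (rule assms)
  interpret coefficient_hom "\<lambda>q. scale q 1"
  proof
    fix q r :: rat
    show "scale (q + r) 1 = scale q 1 + scale r 1" by (rule scale_left_distrib)
    have "scale (q * r) 1 = scale q (1 * scale r 1)" by simp
    also have "\<dots> = scale q 1 * scale r 1" by (rule scale_mult_left)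
    finally show "scale (q * r) 1 = scale q 1 * scale r 1" .
    show "scale 1 1 = (1 :: 'a)" by simp
  qed
  let ?\<theta> = "\<lambda>i. base_change (log_family i)" and ?\<eta> = "\<lambda>i. base_change (exp_family i)"
  have \<theta>: "finite (msupp (log_family i))" for i using log_family_polys by (rule polysD(1))
  have \<eta>: "finite (msupp (exp_family i))" if "i \<ge> 2" for i using exp_family_polys[OF that] by (rule polysD(1))
  have xy: "in_x (?\<theta> i) = base_change (in_x (log_family i))" "in_y (?\<theta> i) = base_change (in_y (log_family i))" for i
    unfolding in_x_def in_y_def by (simp_all add: base_change_msubst[OF \<theta>] base_change_mvar)
  have "admissible {2..} ?\<theta>"
    by (rule admissible_base_change) (auto simp: log_family_polys log_family_nth_0)
  moreover have "admissible {2..} ?\<eta>"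
    by (rule admissible_base_change) (auto simp: exp_family_polys exp_family_nth_0)
  moreover have "inverse_families {2..} ?\<theta> ?\<eta>"
    unfolding inverse_families_def
    by (auto simp: base_change_msubst[symmetric] \<theta> \<eta> log_family_exp_family exp_family_log_family base_change_mvar)
  moreover have "intertwines {2..} boxed_law additive_law ?\<theta>"
    unfolding intertwines_def
  proof
    fix i :: nat assume "i \<in> {2..}"
    then have i: "i \<ge> 2" by simp
    have "msubst (?\<theta> i) boxed_law = base_change (msubst (log_family i) boxed_law)"
      by (simp add: base_change_msubst[OF \<theta>] base_change_boxed_law)
    also have "\<dots> = base_change (in_x (log_family i)) + base_change (in_y (log_family i))"
      by (simp add: log_family_additive[OF i] base_change_add)
    also have "\<dots> = base_change (msubst (additive_law i)
        (case_sum (\<lambda>j. in_x (log_family j)) (\<lambda>j. in_y (log_family j))))"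
      unfolding additive_law_def
      by (simp add: msubst_add[of _ UNIV] polys_mvar msubst_mvar base_change_add)
    also have "\<dots> = msubst (additive_law i) (case_sum (\<lambda>j. in_x (?\<theta> j)) (\<lambda>j. in_y (?\<theta> j)))"
    proof -
      have "(additive_law i :: (nat + nat, rat) mfps) \<in> polys UNIV"
        unfolding additive_law_def by (intro polys_add polys_mvar UNIV_I)
      moreover have "(\<lambda>v. base_change (case_sum (\<lambda>j. in_x (log_family j)) (\<lambda>j. in_y (log_family j)) v)) =
          case_sum (\<lambda>j. in_x (?\<theta> j)) (\<lambda>j. in_y (?\<theta> j))"
        by (rule ext) (simp add: xy split: sum.split)
      ultimately show ?thesis
        by (simp add: base_change_msubst polysD(1) base_change_additive_law)
    qed
    finally show "msubst (?\<theta> i) boxed_law =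
      msubst (additive_law i) (case_sum (\<lambda>j. in_x (?\<theta> j)) (\<lambda>j. in_y (?\<theta> j)))" .
  qed
  ultimately show ?thesis unfolding formal_groups_isomorphic_def by blast
qed

end
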